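(* For every $d\ge2$, all weights $a_1,\dots,a_d>0$ (the edge weights at a pivot with $d$ active neighbors), and every integer $\rho\ge1$, the algorithm CAST-SchurTree$(a_1,\dots,a_d,\rho)$ samples a spanning tree $T$ exactly from the weighted random spanning-tree distribution of the expanded Schur clique and contracts the sampled tree onto the original pivot neighborhood $[d]$ in $O(\rho d)$ time, without materializing (explicitly forming) either the $\Theta(d^2)$-edge Schur clique or the expanded Schur clique.
   Context: Let $a=\sum_{i=1}^d a_i$. The Schur clique is the complete graph on $[d]$ with edge weights $a_ia_j/a$. For each $i\in[d]$ let $P_i=\{(i,1),\dots,(i,\rho)\}$ be a block of auxiliary copies, each $p\in P_i$ having conductance $c_p=a_i/\rho$ and label $\phi(p)=i$; $P=\bigcup_iP_i$, $m=|P|=\rho d$. The expanded Schur clique is the complete graph on $P$ with edge weights $w^{\mathrm{exp}}_{pq}=c_pc_q/a$ ($p\neq q$). Its weighted random spanning-tree distribution is $\mathbb P(T)\propto\prod_{(p,q)\in T}w^{\mathrm{exp}}_{pq}$ over spanning trees $T$ of the complete graph on $P$. Contracting $T$ onto $[d]$ means producing the multiset of triples $(i,j,h)$, one for each edge $(p,q)\in T$ with $i=\phi(p)\ne\phi(q)=j$, with conductance $h=\frac{c_pc_q}{c_p+c_q}=\frac{a_ia_j}{\rho(a_i+a_j)}$; edges of $T$ with $\phi(p)=\phi(q)$ are discarded. Algorithm CAST-SchurTree$(a_1,\dots,a_d,\rho)$ for $d\ge 2$: (1) compute $a$ and $m=\rho d$, and build an alias table for the distribution $\pi_i=a_i/a$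 on $[d]$ (a table built in $O(d)$ time that afterwards allows sampling from $\pi$ in $O(1)$ time per sample); (2) for $t=1,\dots,m-2$, independently sample $i\sim\pi$ and $k$ uniform in $[\rho]$, and set $S_t=(i,k)\in P$; (3) decode the Prüfer code $S=(S_1,\dots,S_{m-2})$ into its spanning tree $T$ on $P$; (4) output the multiset containing, for each edge $(p,q)\in T$ with $i=\phi(p)\neq\phi(q)=j$, the triple $\bigl(i,j,\frac{a_ia_j}{\rho(a_i+a_j)}\bigr)$, discarding the edges of $T$ with $\phi(p)=\phi(q)$. Prüfer decoding, with respect to a fixed total order on $P$: set $r_p=1+|\{t:S_t=p\}|$ for $p\in P$; for $t=1,\dots,m-2$, let $\ell$ be the smallest not-yet-removed label with $r_\ell=1$, add edge $(\ell,S_t)$, remove $\ell$, and decrease $r_{S_t}$ by one; finally join the two remaining labels by an edge. It is the standard bijection between $P^{m-2}$ and labeled trees on $P$ and can be implemented in $O(m)$ time by the standard leaf-pointer method. Time is counted in the unit-cost model: arithmetic operations on real numbers, comparisons, memory accesses, and drawing one uniform random number each take $O(1)$ time. *)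

theory Defs
  imports "HOL-Probability.Probability"
begin

section \<open>Spanning trees of a complete graph and their weighted random distribution\<close>

text \<open>An undirected edge is a two-element set of vertices, and a spanning subgraph is given by its
  set of edges.\<close>

definition complete_edges :: "'v set \<Rightarrow> 'v set set" where
  "complete_edges V = {{u, v} | u v. u \<in> V \<and> v \<in> V \<and> u \<noteq> v}"

definition connected_graph :: "'v set \<Rightarrow> 'v set set \<Rightarrow> bool" where
  "connected_graph V E \<longleftrightarrow> (\<forall>u\<in>V. \<forall>v\<in>V. (u, v) \<in> {(x, y). {x, y} \<in> E}\<^sup>*)"

definition graph_cycle :: "'v set set \<Rightarrow> 'v list \<Rightarrow> bool" where
  "graph_cycle E xs \<longleftrightarrow> 3 \<le> length xs \<and> distinct xs \<and>
     (\<forall>i<length xs. {xs ! i, xs ! (Suc i mod length xs)} \<in> E)"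

definition spanning_trees :: "'v set \<Rightarrow> 'v set set set" where
  "spanning_trees V = {E. E \<subseteq> complete_edges V \<and> connected_graph V E \<and> (\<nexists>xs. graph_cycle E xs)}"

definition rst_prob :: "'v set \<Rightarrow> ('v set \<Rightarrow> real) \<Rightarrow> 'v set set \<Rightarrow> real" where
  "rst_prob V w T = (\<Prod>e\<in>T. w e) / (\<Sum>T'\<in>spanning_trees V. \<Prod>e\<in>T'. w e)"


section \<open>The expanded Schur clique\<close>

text \<open>Indices are 0-based: \<open>[d]\<close> is \<open>{..<d}\<close>, and the auxiliary copies of \<open>i\<close> are the pairs
  \<open>(i, k)\<close> with \<open>k < \<rho>\<close>. The weights are the values of \<open>a\<close> below \<open>d\<close>, and the label \<open>\<phi>\<close> is
  \<^const>\<open>fst\<close>.\<close>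

definition copies :: "nat \<Rightarrow> nat \<Rightarrow> (nat \<times> nat) set" where
  "copies d \<rho> = {..<d} \<times> {..<\<rho>}"

definition total_weight :: "nat \<Rightarrow> (nat \<Rightarrow> real) \<Rightarrow> real" where
  "total_weight d a = (\<Sum>i<d. a i)"

definition copy_cond :: "(nat \<Rightarrow> real) \<Rightarrow> nat \<Rightarrow> nat \<times> nat \<Rightarrow> real" where
  "copy_cond a \<rho> p = a (fst p) / real \<rho>"

definition exp_weight :: "nat \<Rightarrow> (nat \<Rightarrow> real) \<Rightarrow> nat \<Rightarrow> (nat \<times> nat) set \<Rightarrow> real" where
  "exp_weight d a \<rho> e = (\<Prod>p\<in>e. copy_cond a \<rho> p) / total_weight d a"

lemma exp_weight_edge:
  "p \<noteq> q \<Longrightarrow> exp_weight d a \<rho> {p, q} = copy_cond a \<rho> p * copy_cond a \<rho> q / total_weight d a"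
  by (simp add: exp_weight_def)

text \<open>A triple \<open>(i, j, h)\<close> comes from an undirected edge, so the order of \<open>i\<close> and \<open>j\<close> carries no
  meaning; it is represented as \<open>({i, j}, h)\<close>.\<close>

definition triple_cond :: "(nat \<Rightarrow> real) \<Rightarrow> nat \<Rightarrow> (nat \<times> nat) set \<Rightarrow> real" where
  "triple_cond a \<rho> e = (\<Prod>p\<in>e. copy_cond a \<rho> p) / (\<Sum>p\<in>e. copy_cond a \<rho> p)"

lemma triple_cond_edge:
  "p \<noteq> q \<Longrightarrow> triple_cond a \<rho> {p, q} =
     copy_cond a \<rho> p * copy_cond a \<rho> q / (copy_cond a \<rho> p + copy_cond a \<rho> q)"
  by (simp add: triple_cond_def)

definition contract :: "(nat \<Rightarrow> real) \<Rightarrow> nat \<Rightarrow> (nat \<times> nat) set set \<Rightarrow> (nat set \<times> real) multiset" where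
  "contract a \<rho> T =
     {#(fst ` e, triple_cond a \<rho> e). e \<in># mset_set {e \<in> T. \<exists>p\<in>e. \<exists>q\<in>e. fst p \<noteq> fst q}#}"


section \<open>Pruefer decoding\<close>

text \<open>The total order on the labels is given by an injective \<open>rk\<close>; \<open>R\<close> is the set of labels that
  are not yet removed. When the code is used up, \<open>R\<close> consists of two labels and is itself the last
  edge.\<close>

fun prufer_steps :: "('v \<Rightarrow> nat) \<Rightarrow> 'v set \<Rightarrow> ('v \<Rightarrow> nat) \<Rightarrow> 'v list \<Rightarrow> 'v set set" where
  "prufer_steps rk R r [] = {R}"
| "prufer_steps rk R r (s # S) =
     (let l = (ARG_MIN rk p. p \<in> R \<and> r p = 1)
      in insert {l, s} (prufer_steps rk (R - {l}) (r(s := r s - 1)) S))"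

definition prufer_decode :: "('v \<Rightarrow> nat) \<Rightarrow> 'v set \<Rightarrow> 'v list \<Rightarrow> 'v set set" where
  "prufer_decode rk P S = prufer_steps rk P (\<lambda>p. 1 + count_list S p) S"

text \<open>On \<^term>\<open>copies d \<rho>\<close> this is the position in the lexicographic order.\<close>

definition lex_rank :: "nat \<Rightarrow> nat \<times> nat \<Rightarrow> nat" where
  "lex_rank \<rho> p = fst p * \<rho> + snd p"


section \<open>A randomized unit-cost machine\<close>

text \<open>A program has registers and unbounded arrays, addressed by name, for natural numbers and for
  real numbers. Programs are deterministic relative to a tape of independent uniform numbers in
  \<open>[0,1)\<close>; each draw consumes the next entry of the tape.

  Every operator, comparison, register or array access and draw costs one step. The second
  counter, \<open>real_work\<close>, is not a time measure: it counts the arithmetic operations on real numbers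
  and the writes to real arrays, so computing or storing one edge weight counts at least once.
  Neither counter nor the tape position can be read by a program.\<close>

datatype nexp =
    NC nat
  | NV string
  | NAt string nexp
  | NAdd nexp nexp (infixl "+\<^sub>n" 65)
  | NMul nexp nexp (infixl "*\<^sub>n" 70)
  | NSub nexp nexp (infixl "-\<^sub>n" 65)

datatype rexp =
    RC nat
  | RV string
  | RAt string nexp
  | ROf nexp
  | RAdd rexp rexp (infixl "+\<^sub>r" 65)
  | RSub rexp rexp (infixl "-\<^sub>r" 65)
  | RMul rexp rexp (infixl "*\<^sub>r" 70)
  | RDiv rexp rexp (infixl "'/\<^sub>r" 70)

datatype bexp =
    NLess nexp nexp (infix "<\<^sub>n" 50)
  | NEq nexp nexp (infix "=\<^sub>n" 50)
  | RLess rexp rexp (infix "<\<^sub>r" 50)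
  | BNot bexp
  | BAnd bexp bexp (infixr "&\<^sub>b" 35)

datatype com =
    SKIP
  | NSet string nexp ("_ :=\<^sub>n _" [1000, 61] 61)
  | RSet string rexp ("_ :=\<^sub>r _" [1000, 61] 61)
  | NStore string nexp nexp ("_\<lparr>_\<rparr> :=\<^sub>n _" [1000, 0, 61] 61)
  | RStore string nexp rexp ("_\<lparr>_\<rparr> :=\<^sub>r _" [1000, 0, 61] 61)
  | DrawReal string
  | DrawNat string nexp
  | CSeq com com (infixr ";;" 60)
  | CIf bexp com com ("(IF _/ THEN _/ ELSE _)" [0, 0, 61] 61)
  | CWhile bexp com ("(WHILE _/ DO _)" [0, 61] 61)

record state =
  nreg :: "string \<Rightarrow> nat"
  rreg :: "string \<Rightarrow> real"
  narr :: "string \<Rightarrow> nat \<Rightarrow> nat"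
  rarr :: "string \<Rightarrow> nat \<Rightarrow> real"
  tape_pos :: nat
  steps :: nat
  real_work :: nat

primrec nval :: "nexp \<Rightarrow> state \<Rightarrow> nat" where
  "nval (NC n) s = n"
| "nval (NV x) s = nreg s x"
| "nval (NAt x e) s = narr s x (nval e s)"
| "nval (e +\<^sub>n f) s = nval e s + nval f s"
| "nval (e *\<^sub>n f) s = nval e s * nval f s"
| "nval (e -\<^sub>n f) s = nval e s - nval f s"

primrec rval :: "rexp \<Rightarrow> state \<Rightarrow> real" where
  "rval (RC n) s = real n"
| "rval (RV x) s = rreg s x"
| "rval (RAt x e) s = rarr s x (nval e s)"
| "rval (ROf e) s = real (nval e s)"
| "rval (e +\<^sub>r f) s = rval e s + rval f s"
| "rval (e -\<^sub>r f) s = rval e s - rval f s"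
| "rval (e *\<^sub>r f) s = rval e s * rval f s"
| "rval (e /\<^sub>r f) s = rval e s / rval f s"

primrec bval :: "bexp \<Rightarrow> state \<Rightarrow> bool" where
  "bval (e <\<^sub>n f) s \<longleftrightarrow> nval e s < nval f s"
| "bval (e =\<^sub>n f) s \<longleftrightarrow> nval e s = nval f s"
| "bval (e <\<^sub>r f) s \<longleftrightarrow> rval e s < rval f s"
| "bval (BNot b) s \<longleftrightarrow> \<not> bval b s"
| "bval (b &\<^sub>b c) s \<longleftrightarrow> bval b s \<and> bval c s"

primrec ncost :: "nexp \<Rightarrow> nat" where
  "ncost (NC n) = 1"
| "ncost (NV x) = 1"
| "ncost (NAt x e) = 1 + ncost e"
| "ncost (e +\<^sub>n f) = 1 + ncost e + ncost f"
| "ncost (e *\<^sub>n f) = 1 + ncost e + ncost f"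
| "ncost (e -\<^sub>n f) = 1 + ncost e + ncost f"

primrec rcost :: "rexp \<Rightarrow> nat" where
  "rcost (RC n) = 1"
| "rcost (RV x) = 1"
| "rcost (RAt x e) = 1 + ncost e"
| "rcost (ROf e) = 1 + ncost e"
| "rcost (e +\<^sub>r f) = 1 + rcost e + rcost f"
| "rcost (e -\<^sub>r f) = 1 + rcost e + rcost f"
| "rcost (e *\<^sub>r f) = 1 + rcost e + rcost f"
| "rcost (e /\<^sub>r f) = 1 + rcost e + rcost f"

primrec bcost :: "bexp \<Rightarrow> nat" where
  "bcost (e <\<^sub>n f) = 1 + ncost e + ncost f"
| "bcost (e =\<^sub>n f) = 1 + ncost e + ncost f"
| "bcost (e <\<^sub>r f) = 1 + rcost e + rcost f"
| "bcost (BNot b) = 1 + bcost b"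
| "bcost (b &\<^sub>b c) = 1 + bcost b + bcost c"

primrec rops :: "rexp \<Rightarrow> nat" where
  "rops (RC n) = 0"
| "rops (RV x) = 0"
| "rops (RAt x e) = 0"
| "rops (ROf e) = 0"
| "rops (e +\<^sub>r f) = 1 + rops e + rops f"
| "rops (e -\<^sub>r f) = 1 + rops e + rops f"
| "rops (e *\<^sub>r f) = 1 + rops e + rops f"
| "rops (e /\<^sub>r f) = 1 + rops e + rops f"

primrec brops :: "bexp \<Rightarrow> nat" where
  "brops (e <\<^sub>n f) = 0"
| "brops (e =\<^sub>n f) = 0"
| "brops (e <\<^sub>r f) = rops e + rops f"
| "brops (BNot b) = brops b"
| "brops (b &\<^sub>b c) = brops b + brops c"

definition charge :: "nat \<Rightarrow> nat \<Rightarrow> state \<Rightarrow> state" where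
  "charge k w s = s\<lparr>steps := steps s + k, real_work := real_work s + w\<rparr>"

text \<open>\<open>exec \<omega> c s t\<close>: on tape \<open>\<omega>\<close>, the program \<open>c\<close> started in \<open>s\<close> terminates in \<open>t\<close>. For a uniform
  \<open>u\<close> in \<open>[0,1)\<close>, the number \<open>\<lfloor>n * u\<rfloor>\<close> drawn by \<open>DrawNat\<close> is uniform in \<open>{..<n}\<close>.\<close>

inductive exec :: "(nat \<Rightarrow> real) \<Rightarrow> com \<Rightarrow> state \<Rightarrow> state \<Rightarrow> bool" for \<omega> where
  Skip: "exec \<omega> SKIP s (charge 1 0 s)"
| NSet: "exec \<omega> (x :=\<^sub>n e) s
    ((charge (1 + ncost e) 0 s)\<lparr>nreg := (nreg s)(x := nval e s)\<rparr>)"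
| RSet: "exec \<omega> (x :=\<^sub>r e) s
    ((charge (1 + rcost e) (rops e) s)\<lparr>rreg := (rreg s)(x := rval e s)\<rparr>)"
| NStore: "exec \<omega> (x\<lparr>i\<rparr> :=\<^sub>n e) s
    ((charge (1 + ncost i + ncost e) 0 s)
       \<lparr>narr := (narr s)(x := (narr s x)(nval i s := nval e s))\<rparr>)"
| RStore: "exec \<omega> (x\<lparr>i\<rparr> :=\<^sub>r e) s
    ((charge (1 + ncost i + rcost e) (1 + rops e) s)
       \<lparr>rarr := (rarr s)(x := (rarr s x)(nval i s := rval e s))\<rparr>)"
| DrawReal: "exec \<omega> (DrawReal x) s
    ((charge 1 0 s)\<lparr>rreg := (rreg s)(x := \<omega> (tape_pos s)), tape_pos := tape_pos s + 1\<rparr>)"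
| DrawNat: "exec \<omega> (DrawNat x e) s
    ((charge (1 + ncost e) 0 s)
       \<lparr>nreg := (nreg s)(x := nat \<lfloor>real (nval e s) * \<omega> (tape_pos s)\<rfloor>), tape_pos := tape_pos s + 1\<rparr>)"
| Seq: "exec \<omega> c s t \<Longrightarrow> exec \<omega> c' t t' \<Longrightarrow> exec \<omega> (c ;; c') s t'"
| IfTrue: "bval b s \<Longrightarrow> exec \<omega> c (charge (1 + bcost b) (brops b) s) t
    \<Longrightarrow> exec \<omega> (IF b THEN c ELSE c') s t"
| IfFalse: "\<not> bval b s \<Longrightarrow> exec \<omega> c' (charge (1 + bcost b) (brops b) s) t
    \<Longrightarrow> exec \<omega> (IF b THEN c ELSE c') s t"
| WhileFalse: "\<not> bval b s
    \<Longrightarrow> exec \<omega> (WHILE b DO c) s (charge (1 + bcost b) (brops b) s)"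
| WhileTrue: "bval b s \<Longrightarrow> exec \<omega> c (charge (1 + bcost b) (brops b) s) t
    \<Longrightarrow> exec \<omega> (WHILE b DO c) t t' \<Longrightarrow> exec \<omega> (WHILE b DO c) s t'"

inductive_cases exec_basicE:
  "exec \<omega> SKIP s t" "exec \<omega> (x :=\<^sub>n e) s t" "exec \<omega> (x :=\<^sub>r e') s t"
  "exec \<omega> (x\<lparr>i\<rparr> :=\<^sub>n e) s t" "exec \<omega> (x\<lparr>i\<rparr> :=\<^sub>r e') s t"
  "exec \<omega> (DrawReal x) s t" "exec \<omega> (DrawNat x e) s t"
inductive_cases exec_SeqE: "exec \<omega> (c ;; c') s t"
inductive_cases exec_IfE: "exec \<omega> (IF b THEN c ELSE c') s t"
inductive_cases exec_WhileE: "exec \<omega> (WHILE b DO c) s t"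

lemma exec_deterministic: "exec \<omega> c s t \<Longrightarrow> exec \<omega> c s t' \<Longrightarrow> t = t'"
proof (induction arbitrary: t' rule: exec.induct)
  case (Seq c s t c' t'')
  from Seq.prems obtain u where "exec \<omega> c s u" "exec \<omega> c' u t'" by (rule exec_SeqE)
  then show ?case using Seq.IH by simp
next
  case (IfTrue b s c t c')
  from IfTrue.prems show ?case by (rule exec_IfE) (simp_all add: IfTrue.IH IfTrue.hyps)
next
  case (IfFalse b s c' t c)
  from IfFalse.prems show ?case by (rule exec_IfE) (simp_all add: IfFalse.IH IfFalse.hyps)
next
  case (WhileFalse b s c)
  from WhileFalse.prems show ?case by (rule exec_WhileE) (simp_all add: WhileFalse.hyps)
next
  case (WhileTrue b s c t t'')
  from WhileTrue.prems show ?case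
  proof (rule exec_WhileE)
    fix u assume "exec \<omega> c (charge (Suc (bcost b)) (brops b) s) u" "exec \<omega> (WHILE b DO c) u t'"
    then show ?thesis using WhileTrue.IH by simp
  qed (simp add: WhileTrue.hyps)
qed (erule exec_basicE, simp)+

definition tapes :: "(nat \<Rightarrow> real) measure" where
  "tapes = (\<Pi>\<^sub>M n\<in>UNIV. restrict_space lborel {0..<1})"


section \<open>CAST-SchurTree as a program\<close>

text \<open>The input is \<open>d\<close>, \<open>\<rho>\<close> and the array \<open>a\<close>. A copy \<open>(i, k)\<close> is represented by the number
  \<^term>\<open>lex_rank \<rho> (i, k)\<close>.\<close>

definition initial_state :: "nat \<Rightarrow> (nat \<Rightarrow> real) \<Rightarrow> nat \<Rightarrow> state" where
  "initial_state d a \<rho> =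
     \<lparr>nreg = (\<lambda>_. 0)(''d'' := d, ''rho'' := \<rho>), rreg = (\<lambda>_. 0),
      narr = (\<lambda>_ _. 0), rarr = (\<lambda>_ _. 0)(''a'' := (\<lambda>i. if i < d then a i else 0)),
      tape_pos = 0, steps = 0, real_work = 0\<rparr>"

definition incr :: "string \<Rightarrow> com" where
  "incr x = (x :=\<^sub>n (NV x +\<^sub>n NC 1))"

definition push :: "string \<Rightarrow> string \<Rightarrow> string \<Rightarrow> com" where
  "push y h x = (y\<lparr>NV h\<rparr> :=\<^sub>n NV x ;; incr h)"

definition pop :: "string \<Rightarrow> string \<Rightarrow> string \<Rightarrow> com" where
  "pop y h x = (h :=\<^sub>n (NV h -\<^sub>n NC 1) ;; x :=\<^sub>n NAt y (NV h))"

text \<open>Vose's construction of the alias table. Starting from the scaled weights \<open>d * a\<^sub>i / a\<close>, an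
  underfull column is repeatedly topped up from an overfull one. Column \<open>j\<close> of the table yields
  \<open>j\<close> with probability \<open>prob j\<close> and \<open>alias j\<close> otherwise.\<close>

definition build_alias_table :: com where
  "build_alias_table =
   (''total'' :=\<^sub>r RC 0 ;;
    ''i'' :=\<^sub>n NC 0 ;;
    WHILE NV ''i'' <\<^sub>n NV ''d'' DO (
      ''total'' :=\<^sub>r (RV ''total'' +\<^sub>r RAt ''a'' (NV ''i'')) ;;
      incr ''i'') ;;
    ''m'' :=\<^sub>n (NV ''rho'' *\<^sub>n NV ''d'') ;;
    ''small_height'' :=\<^sub>n NC 0 ;;
    ''large_height'' :=\<^sub>n NC 0 ;;
    ''i'' :=\<^sub>n NC 0 ;;
    WHILE NV ''i'' <\<^sub>n NV ''d'' DO (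
      ''prob''\<lparr>NV ''i''\<rparr> :=\<^sub>r (ROf (NV ''d'') *\<^sub>r RAt ''a'' (NV ''i'') /\<^sub>r RV ''total'') ;;
      ''alias''\<lparr>NV ''i''\<rparr> :=\<^sub>n NV ''i'' ;;
      IF RAt ''prob'' (NV ''i'') <\<^sub>r RC 1
        THEN push ''small'' ''small_height'' ''i''
        ELSE push ''large'' ''large_height'' ''i'' ;;
      incr ''i'') ;;
    WHILE (NC 0 <\<^sub>n NV ''small_height'') &\<^sub>b (NC 0 <\<^sub>n NV ''large_height'') DO (
      pop ''small'' ''small_height'' ''s'' ;;
      pop ''large'' ''large_height'' ''l'' ;;
      ''alias''\<lparr>NV ''s''\<rparr> :=\<^sub>n NV ''l'' ;;
      ''prob''\<lparr>NV ''l''\<rparr> :=\<^sub>r (RAt ''prob'' (NV ''l'') -\<^sub>r (RC 1 -\<^sub>r RAt ''prob'' (NV ''s''))) ;;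
      IF RAt ''prob'' (NV ''l'') <\<^sub>r RC 1
        THEN push ''small'' ''small_height'' ''l''
        ELSE push ''large'' ''large_height'' ''l''))"

definition sample_code :: com where
  "sample_code =
   (''t'' :=\<^sub>n NC 0 ;;
    WHILE NV ''t'' <\<^sub>n (NV ''m'' -\<^sub>n NC 2) DO (
      DrawNat ''j'' (NV ''d'') ;;
      DrawReal ''u'' ;;
      IF RV ''u'' <\<^sub>r RAt ''prob'' (NV ''j'')
        THEN ''i'' :=\<^sub>n NV ''j''
        ELSE ''i'' :=\<^sub>n NAt ''alias'' (NV ''j'') ;;
      DrawNat ''k'' (NV ''rho'') ;;
      ''S''\<lparr>NV ''t''\<rparr> :=\<^sub>n (NV ''i'' *\<^sub>n NV ''rho'' +\<^sub>n NV ''k'') ;;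
      incr ''t''))"

text \<open>The first loop also tabulates the labels \<open>\<phi>\<close>, since the machine has no integer division.
  \<open>r\<close> is 0 for removed copies. The current leaf is \<open>ptr\<close> or the copy whose count just dropped to
  1; the edges are stored as the pairs \<open>(U t, V t)\<close>. The largest copy is never removed.\<close>

definition next_leaf :: com where
  "next_leaf =
   (WHILE BNot (NAt ''r'' (NV ''ptr'') =\<^sub>n NC 1) DO incr ''ptr'' ;;
    ''leaf'' :=\<^sub>n NV ''ptr'')"

definition decode_code :: com where
  "decode_code =
   (''p'' :=\<^sub>n NC 0 ;;
    ''i'' :=\<^sub>n NC 0 ;;
    WHILE NV ''i'' <\<^sub>n NV ''d'' DO (
      ''k'' :=\<^sub>n NC 0 ;;
      WHILE NV ''k'' <\<^sub>n NV ''rho'' DO (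
        ''phi''\<lparr>NV ''p''\<rparr> :=\<^sub>n NV ''i'' ;;
        ''r''\<lparr>NV ''p''\<rparr> :=\<^sub>n NC 1 ;;
        incr ''p'' ;;
        incr ''k'') ;;
      incr ''i'') ;;
    ''t'' :=\<^sub>n NC 0 ;;
    WHILE NV ''t'' <\<^sub>n (NV ''m'' -\<^sub>n NC 2) DO (
      ''v'' :=\<^sub>n NAt ''S'' (NV ''t'') ;;
      ''r''\<lparr>NV ''v''\<rparr> :=\<^sub>n (NAt ''r'' (NV ''v'') +\<^sub>n NC 1) ;;
      incr ''t'') ;;
    ''ptr'' :=\<^sub>n NC 0 ;;
    next_leaf ;;
    ''t'' :=\<^sub>n NC 0 ;;
    WHILE NV ''t'' <\<^sub>n (NV ''m'' -\<^sub>n NC 2) DO (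
      ''v'' :=\<^sub>n NAt ''S'' (NV ''t'') ;;
      ''U''\<lparr>NV ''t''\<rparr> :=\<^sub>n NV ''leaf'' ;;
      ''V''\<lparr>NV ''t''\<rparr> :=\<^sub>n NV ''v'' ;;
      ''r''\<lparr>NV ''leaf''\<rparr> :=\<^sub>n NC 0 ;;
      ''r''\<lparr>NV ''v''\<rparr> :=\<^sub>n (NAt ''r'' (NV ''v'') -\<^sub>n NC 1) ;;
      IF (NAt ''r'' (NV ''v'') =\<^sub>n NC 1) &\<^sub>b (NV ''v'' <\<^sub>n NV ''ptr'')
        THEN ''leaf'' :=\<^sub>n NV ''v''
        ELSE next_leaf ;;
      incr ''t'') ;;
    ''U''\<lparr>NV ''t''\<rparr> :=\<^sub>n NV ''leaf'' ;;
    ''V''\<lparr>NV ''t''\<rparr> :=\<^sub>n (NV ''m'' -\<^sub>n NC 1))"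

definition contract_tree :: com where
  "contract_tree =
   (''count'' :=\<^sub>n NC 0 ;;
    ''t'' :=\<^sub>n NC 0 ;;
    WHILE NV ''t'' <\<^sub>n (NV ''m'' -\<^sub>n NC 1) DO (
      ''i'' :=\<^sub>n NAt ''phi'' (NAt ''U'' (NV ''t'')) ;;
      ''j'' :=\<^sub>n NAt ''phi'' (NAt ''V'' (NV ''t'')) ;;
      IF NV ''i'' =\<^sub>n NV ''j'' THEN SKIP ELSE (
        ''I''\<lparr>NV ''count''\<rparr> :=\<^sub>n NV ''i'' ;;
        ''J''\<lparr>NV ''count''\<rparr> :=\<^sub>n NV ''j'' ;;
        ''H''\<lparr>NV ''count''\<rparr> :=\<^sub>r
          (RAt ''a'' (NV ''i'') *\<^sub>r RAt ''a'' (NV ''j'') /\<^sub>r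
            (ROf (NV ''rho'') *\<^sub>r (RAt ''a'' (NV ''i'') +\<^sub>r RAt ''a'' (NV ''j'')))) ;;
        incr ''count'') ;;
      incr ''t''))"

definition sample_tree :: com where
  "sample_tree = (build_alias_table ;; sample_code ;; decode_code)"

definition cast_schur_tree :: com where
  "cast_schur_tree = (sample_tree ;; contract_tree)"

definition copy_at :: "nat \<Rightarrow> nat \<Rightarrow> nat \<times> nat" where
  "copy_at \<rho> n = (n div \<rho>, n mod \<rho>)"

definition code_of :: "nat \<Rightarrow> nat \<Rightarrow> state \<Rightarrow> (nat \<times> nat) list" where
  "code_of d \<rho> s = map (\<lambda>t. copy_at \<rho> (narr s ''S'' t)) [0..<\<rho> * d - 2]"

definition tree_of :: "nat \<Rightarrow> nat \<Rightarrow> state \<Rightarrow> (nat \<times> nat) set set" where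
  "tree_of d \<rho> s =
     (\<lambda>t. {copy_at \<rho> (narr s ''U'' t), copy_at \<rho> (narr s ''V'' t)}) ` {..<\<rho> * d - 1}"

definition output_of :: "state \<Rightarrow> (nat set \<times> real) multiset" where
  "output_of s = {#({narr s ''I'' t, narr s ''J'' t}, rarr s ''H'' t).
     t \<in># mset_set {..<nreg s ''count''}#}"

end

theory Submission
  imports Defs
begin

text \<open>In the tree decoded from a Pruefer code, the degree of a vertex is one more than its number of
  occurrences in the code. The edge weights are products over the endpoints, so the weight of
  the tree is a constant times the product of the conductances along the code. Decoding is a
  bijection, hence a code with independent entries, each proportional to the conductance, decodes
  to a tree with the required distribution.

  Each entry of the code is computed from three consecutive numbers on the tape. For a fixed choice
  of columns of the alias table, prescribing the code restricts the tape to a box; the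
  distribution of the code is the sum of the volumes of these boxes. In the decoding loop, the leaf
  pointer only moves forward, because below it there is never a leaf other than the current one.\<close>


section \<open>Trees, leaves and Pruefer codes\<close>

text \<open>The probability of a given code can be computed only if the table is the same on every
  tape. Building it draws nothing, so one run fixes it, and the code becomes an explicit function of
  the tape. A single entry is still not a product event: the threshold tested by the second number
  depends on the column chosen by the first. Hence the sum over column choices.

  The machine decodes numbers below \<open>\<rho> * d\<close>, whereas the statement speaks of
  pairs; decoding commutes with order-preserving relabelling, which carries the result over. Edges
  are stored in positions, whereas \<open>contract\<close> ranges over a set, so the output agrees
  with it only if no edge is stored twice; a spanning tree has \<open>\<rho> * d - 1\<close> edges,
  one for each position.

  Real arithmetic occurs only in the alias table (linear in \<open>d\<close>) and in writing the
  output triples (a constant amount for each): this is how the absence of a clique shows in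
  \<open>real_work\<close>. The pointer scans are paid for by the distance that the pointer moves,
  which keeps the decoder linear.\<close>

definition vertex_degree :: "'v set set \<Rightarrow> 'v \<Rightarrow> nat" where
  "vertex_degree E v = card {e \<in> E. v \<in> e}"

abbreviation adj :: "'v set set \<Rightarrow> ('v \<times> 'v) set" where
  "adj E \<equiv> {(x, y). {x, y} \<in> E}"

lemma complete_edges_mono: "V \<subseteq> W \<Longrightarrow> complete_edges V \<subseteq> complete_edges W"
  unfolding complete_edges_def by blast

lemma finite_complete_edges: "finite V \<Longrightarrow> finite (complete_edges V)"
  by (rule finite_subset[of _ "Pow V"]) (auto simp: complete_edges_def)

lemma complete_edgesD: "{x, y} \<in> complete_edges V \<Longrightarrow> x \<in> V \<and> y \<in> V \<and> x \<noteq> y"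
  by (auto simp: complete_edges_def doubleton_eq_iff)

lemma spanning_trees_finite: "\<lbrakk>T \<in> spanning_trees V; finite V\<rbrakk> \<Longrightarrow> finite T"
  by (auto simp: spanning_trees_def intro: finite_subset finite_complete_edges)

lemma complete_edges_memE:
  assumes "e \<in> complete_edges V" "v \<in> e"
  obtains w where "e = {v, w}" "w \<in> V" "v \<in> V" "v \<noteq> w"
  using assms unfolding complete_edges_def by blast

lemma graph_cycle_mono: "graph_cycle E xs \<Longrightarrow> E \<subseteq> F \<Longrightarrow> graph_cycle F xs"
  unfolding graph_cycle_def by blast

text \<open>The two neighbours of \<open>v\<close> along the cycle differ because a cycle has at
  least three vertices. So a vertex with a single neighbour lies on no cycle.\<close>

lemma graph_cycle_two_edges:
  assumes "graph_cycle E xs" "v \<in> set xs"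
  obtains x y where "x \<noteq> y" "{v, x} \<in> E" "{v, y} \<in> E"
proof -
  let ?n = "length xs"
  from assms(2) obtain i where i: "i < ?n" "xs ! i = v"
    by (auto simp: in_set_conv_nth)
  have n: "3 \<le> ?n" and dist: "distinct xs"
    and E: "\<And>i. i < ?n \<Longrightarrow> {xs ! i, xs ! (Suc i mod ?n)} \<in> E"
    using assms(1) by (auto simp: graph_cycle_def)
  define j where "j = Suc i mod ?n"
  \<comment> \<open>The cyclic predecessor of \<open>i\<close>, given by cases because
    \<open>i - 1\<close> is truncated at 0.\<close>
  define k where "k = (if i = 0 then ?n - 1 else i - 1)"
  have k: "k < ?n" "Suc k mod ?n = i" using i n by (auto simp: k_def)
  have j: "j < ?n" unfolding j_def using n by (intro mod_less_divisor) auto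
  have "j \<noteq> k" using i n unfolding j_def k_def by (auto simp: mod_Suc)
  hence "xs ! j \<noteq> xs ! k" using dist j k(1) by (simp add: nth_eq_iff_index_eq)
  moreover have "{v, xs ! j} \<in> E" using E[OF i(1)] i(2) by (simp add: j_def)
  moreover have "{v, xs ! k} \<in> E" using E[OF k(1)] k(2) i(2) by (simp add: insert_commute)
  ultimately show thesis by (rule that)
qed

lemma adj_rtrancl_sym: "(x, y) \<in> (adj E)\<^sup>* \<Longrightarrow> (y, x) \<in> (adj E)\<^sup>*"
  by (rule symD[OF sym_rtrancl]) (auto intro!: symI simp: insert_commute)

text \<open>All old vertices reach \<open>s\<close>, and \<open>l\<close> is adjacent to it. A cycle
  through \<open>l\<close> would need a second neighbour of \<open>l\<close>; a cycle avoiding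
  \<open>l\<close> already lies in \<open>T\<close>.\<close>

lemma spanning_trees_insert_leaf:
  assumes T: "T \<in> spanning_trees V" and l: "l \<notin> V" and s: "s \<in> V"
  shows "insert {l, s} T \<in> spanning_trees (insert l V)"
proof -
  let ?T = "insert {l, s} T"
  have TE: "T \<subseteq> complete_edges V" and conn: "connected_graph V T"
    and acyc: "\<And>xs. \<not> graph_cycle T xs"
    using T by (auto simp: spanning_trees_def)
  have "{l, s} \<in> complete_edges (insert l V)"
    using l s unfolding complete_edges_def by blast
  hence 1: "?T \<subseteq> complete_edges (insert l V)"
    using TE complete_edges_mono[of V "insert l V"] by blast
  have old: "(u, v) \<in> (adj ?T)\<^sup>*" if "u \<in> V" "v \<in> V" for u v
  proof -
    have "(u, v) \<in> (adj T)\<^sup>*" using conn that by (simp add: connected_graph_def)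
    thus ?thesis by (rule rtrancl_mono[THEN subsetD, rotated]) auto
  qed
  have ls: "(l, s) \<in> (adj ?T)\<^sup>*" by (rule r_into_rtrancl) simp
  have to_s: "(u, s) \<in> (adj ?T)\<^sup>*" if "u \<in> insert l V" for u
    using that old s ls by auto
  have 2: "connected_graph (insert l V) ?T"
    unfolding connected_graph_def
    by (intro ballI rtrancl_trans[OF to_s adj_rtrancl_sym[OF to_s]])
  have nbr: "x = s" if "{l, x} \<in> ?T" for x
    using that l TE complete_edgesD[of l x V] by (auto simp: doubleton_eq_iff)
  have 3: "\<not> graph_cycle ?T xs" for xs
  proof
    assume c: "graph_cycle ?T xs"
    have "l \<notin> set xs"
      using graph_cycle_two_edges[OF c, of l] nbr by metis
    hence "xs ! i \<noteq> l" if "i < length xs" for i using that by auto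
    moreover have "Suc i mod length xs < length xs" if "i < length xs" for i
      using that by (intro mod_less_divisor) auto
    ultimately have "graph_cycle T xs"
      using c unfolding graph_cycle_def by (auto simp: doubleton_eq_iff)
    thus False using acyc by blast
  qed
  show ?thesis using 1 2 3 by (simp add: spanning_trees_def)
qed

text \<open>A walk between other vertices that visits \<open>l\<close> enters and leaves it through
  \<open>s\<close>, so the detour can be cut out.\<close>

lemma spanning_trees_remove_leaf:
  assumes T: "T \<in> spanning_trees V" and l: "{e \<in> T. l \<in> e} = {{l, s}}"
  shows "T - {{l, s}} \<in> spanning_trees (V - {l})"
proof -
  let ?T = "T - {{l, s}}"
  have TE: "T \<subseteq> complete_edges V" and conn: "connected_graph V T"
    and acyc: "\<And>xs. \<not> graph_cycle T xs"
    using T by (auto simp: spanning_trees_def)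
  have "{l, s} \<in> T" using l by blast
  hence ls: "l \<noteq> s" "s \<in> V" using TE complete_edgesD[of l s V] by auto
  have 1: "?T \<subseteq> complete_edges (V - {l})"
  proof
    fix e assume e: "e \<in> ?T"
    hence "l \<notin> e" using l by blast
    thus "e \<in> complete_edges (V - {l})" using e TE unfolding complete_edges_def by blast
  qed
  \<comment> \<open>The induction must also cover walks that currently stop at \<open>l\<close>; for
    these the claim records that \<open>s\<close> is reachable, which is where the next step
    leads.\<close>
  have "(v \<noteq> l \<longrightarrow> (u, v) \<in> (adj ?T)\<^sup>*) \<and> (v = l \<longrightarrow> (u, s) \<in> (adj ?T)\<^sup>*)"
    if "(u, v) \<in> (adj T)\<^sup>*" "u \<noteq> l" for u v
    using that
  proof (induction rule: rtrancl_induct)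
    case base
    thus ?case by simp
  next
    case (step y z)
    have yz: "{y, z} \<in> T" using step by simp
    show ?case
    proof (cases "y = l \<or> z = l")
      case True
      hence "{y, z} \<in> {e \<in> T. l \<in> e}" using yz True by auto
      hence "{y, z} = {l, s}" unfolding l by simp
      hence "y = l \<and> z = s \<or> y = s \<and> z = l" by (auto simp: doubleton_eq_iff)
      thus ?thesis using step.IH step.prems ls(1) by (elim disjE) simp_all
    next
      case False
      hence "(y, z) \<in> adj ?T" using yz by (auto simp: doubleton_eq_iff)
      moreover have "(u, y) \<in> (adj ?T)\<^sup>*" using step.IH step.prems False by simp
      ultimately have "(u, z) \<in> (adj ?T)\<^sup>*" by (rule rtrancl_into_rtrancl[rotated])
      thus ?thesis using False by simp
    qed
  qed
  hence 2: "connected_graph (V - {l}) ?T"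
    using conn by (simp add: connected_graph_def)
  have 3: "\<not> graph_cycle ?T xs" for xs
    using acyc graph_cycle_mono[of ?T xs T] by blast
  show ?thesis using 1 2 3 by (simp add: spanning_trees_def)
qed

text \<open>The end of a longest simple path is a leaf: a further neighbour would either extend the path
  or close a cycle.\<close>

lemma spanning_trees_leaf_exists:
  assumes T: "T \<in> spanning_trees V" and fin: "finite V" and V: "2 \<le> card V"
  obtains l s where "{e \<in> T. l \<in> e} = {{l, s}}"
proof -
  have TE: "T \<subseteq> complete_edges V" and conn: "connected_graph V T"
    and acyc: "\<And>xs. \<not> graph_cycle T xs"
    using T by (auto simp: spanning_trees_def)
  \<comment> \<open>Two vertices are demanded so that the first one has the neighbour
    \<open>xs ! 1\<close>.\<close>
  define path where "path xs \<longleftrightarrow> distinct xs \<and> set xs \<subseteq> V \<and> 2 \<le> length xs \<and>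
      (\<forall>i. Suc i < length xs \<longrightarrow> {xs ! i, xs ! Suc i} \<in> T)" for xs
  obtain u v where uv: "u \<in> V" "v \<in> V" "u \<noteq> v"
    using V fin by (metis One_nat_def Suc_1 card_le_Suc0_iff_eq not_less_eq_eq)
  have "(u, v) \<in> (adj T)\<^sup>*" using conn uv by (simp add: connected_graph_def)
  then obtain w where w: "{u, w} \<in> T" using uv(3)
    by (cases rule: converse_rtranclE) auto
  have "path [u, w]" using w TE complete_edgesD[of u w V] unfolding path_def by (auto simp: less_Suc_eq)
  moreover have "\<forall>xs. path xs \<longrightarrow> length xs < Suc (card V)"
    using card_mono[OF fin] unfolding path_def by (metis distinct_card le_imp_less_Suc)
  ultimately have "\<exists>xs. path xs \<and> (\<forall>ys. path ys \<longrightarrow> length ys \<le> length xs)"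
    by (rule ex_has_greatest_nat)
  then obtain xs where xs: "path xs" and max: "\<And>ys. path ys \<Longrightarrow> length ys \<le> length xs"
    by blast
  define n where "n = length xs"
  have dist: "distinct xs" and sub: "set xs \<subseteq> V" and n: "2 \<le> n"
    and E: "\<And>i. Suc i < n \<Longrightarrow> {xs ! i, xs ! Suc i} \<in> T"
    using xs by (auto simp: path_def n_def)
  have e01: "{xs ! 0, xs ! 1} \<in> T" using E[of 0] n by simp
  have "y = xs ! 1" if y: "{xs ! 0, y} \<in> T" for y
  proof (rule ccontr)
    assume y1: "y \<noteq> xs ! 1"
    have yV: "y \<in> V" "y \<noteq> xs ! 0" using y TE complete_edgesD[of "xs ! 0" y V] by auto
    show False
    proof (cases "y \<in> set xs")
      case False
      have "path (y # xs)" unfolding path_def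
        using False dist sub n E y yV
        by (auto simp: n_def nth_Cons insert_commute split: nat.splits)
      thus False using max by fastforce
    next
      case True
      then obtain j where j: "j < n" "xs ! j = y" by (auto simp: in_set_conv_nth n_def)
      have "j \<noteq> 0" using j(2) yV(2) by (cases "j = 0") simp_all
      moreover have "j \<noteq> 1" using j(2) y1 by (cases "j = 1") simp_all
      ultimately have j2: "2 \<le> j" by simp
      \<comment> \<open>The chord from \<open>xs ! 0\<close> to \<open>xs ! j\<close> closes the
        prefix of length \<open>Suc j\<close>; at \<open>i = j\<close> the index wraps around to 0.
        The length is at least 3 by \<open>2 \<le> j\<close>.\<close>
      have "{take (Suc j) xs ! i, take (Suc j) xs ! (Suc i mod Suc j)} \<in> T" if "i < Suc j" for i
      proof (cases "i = j")
        case True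
        thus ?thesis using y j(2) by (simp add: insert_commute)
      next
        case False
        hence "i < j" using that by simp
        thus ?thesis using E[of i] j(1) by simp
      qed
      moreover have "length (take (Suc j) xs) = Suc j" using j by (simp add: n_def)
      ultimately have "graph_cycle T (take (Suc j) xs)"
        using j2 dist unfolding graph_cycle_def by (metis Suc_le_mono distinct_take numeral_3_eq_3 numeral_2_eq_2)
      thus False using acyc by blast
    qed
  qed
  hence "e = {xs ! 0, xs ! 1}" if "e \<in> T" "xs ! 0 \<in> e" for e
    using that complete_edges_memE[of e V "xs ! 0"] TE by (metis subsetD)
  hence "{e \<in> T. xs ! 0 \<in> e} = {{xs ! 0, xs ! 1}}"
    using e01 by blast
  thus thesis by (rule that)
qed

lemma spanning_trees_two:
  assumes "x \<noteq> y"
  shows "spanning_trees {x, y} = {{{x, y}}}"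
proof -
  have ce: "complete_edges {x, y} = {{x, y}}" using assms by (auto simp: complete_edges_def)
  have "\<not> graph_cycle {{x, y}} xs" for xs
  proof
    assume c: "graph_cycle {{x, y}} xs"
    hence "xs \<noteq> []" by (auto simp: graph_cycle_def)
    then obtain v where "v \<in> set xs" by (cases xs) auto
    from graph_cycle_two_edges[OF c this] show False by (metis doubleton_eq_iff singletonD)
  qed
  moreover have "connected_graph {x, y} {{x, y}}"
    unfolding connected_graph_def by (auto simp: insert_commute intro: r_into_rtrancl)
  moreover have "\<not> connected_graph {x, y} {}"
    using assms by (auto simp: connected_graph_def)
  ultimately show ?thesis unfolding spanning_trees_def ce by (auto simp: subset_singleton_iff)
qed

lemma spanning_tree_card_two:
  assumes "card V = 2"
  shows "spanning_trees V = {{V}}"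
  using assms spanning_trees_two by (metis card_2_iff)

lemma vertex_degree_insert:
  "\<lbrakk>finite E; e \<notin> E\<rbrakk> \<Longrightarrow> vertex_degree (insert e E) v = vertex_degree E v + of_bool (v \<in> e)"
proof -
  assume "finite E" "e \<notin> E"
  moreover have "{e' \<in> insert e E. v \<in> e'} =
      (if v \<in> e then insert e {e' \<in> E. v \<in> e'} else {e' \<in> E. v \<in> e'})" by auto
  ultimately show ?thesis by (simp add: vertex_degree_def)
qed


section \<open>Pruefer decoding as a bijection between codes and spanning trees\<close>

lemma prufer_decode_Nil: "prufer_decode rk R [] = {R}"
  by (simp add: prufer_decode_def)

text \<open>A counter is 1 exactly for a label missing from the remaining code, and injectivity of
  \<open>rk\<close> makes the smallest such label unique. This trades counters and
  \<open>ARG_MIN\<close> for membership in the code. The updated counters are again those that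
  \<open>prufer_decode\<close> computes from \<open>S\<close>.\<close>

lemma prufer_decode_Cons:
  assumes inj: "inj_on rk R" and l: "l \<in> R" "l \<notin> set (s # S)"
    and min: "\<And>p. \<lbrakk>p \<in> R; p \<notin> set (s # S)\<rbrakk> \<Longrightarrow> rk l \<le> rk p"
  shows "prufer_decode rk R (s # S) = insert {l, s} (prufer_decode rk (R - {l}) S)"
proof -
  let ?r = "\<lambda>p. 1 + count_list (s # S) p"
  define leaf where "leaf p \<longleftrightarrow> p \<in> R \<and> ?r p = 1" for p
  have leaf: "leaf p \<longleftrightarrow> p \<in> R \<and> p \<notin> set (s # S)" for p
    unfolding leaf_def by (simp add: count_list_0_iff)
  have "leaf l" using l by (simp add: leaf)
  from arg_min_nat_lemma[of leaf, OF this, of rk]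
  have "leaf (arg_min rk leaf)" "rk (arg_min rk leaf) \<le> rk l" using \<open>leaf l\<close> by auto
  with min l inj have "arg_min rk leaf = l" by (auto simp: leaf inj_on_def intro!: le_antisym)
  moreover have "?r(s := ?r s - 1) = (\<lambda>p. 1 + count_list S p)" by auto
  ultimately show ?thesis by (simp add: prufer_decode_def leaf_def[abs_def] Let_def)
qed

lemma card_less_obtain_min:
  fixes rk :: "'v \<Rightarrow> nat"
  assumes "card B < card A" "finite B"
  obtains l where "l \<in> A" "l \<notin> B" "\<And>p. \<lbrakk>p \<in> A; p \<notin> B\<rbrakk> \<Longrightarrow> rk l \<le> rk p"
proof -
  have "\<not> A \<subseteq> B" using assms card_mono[of B A] by auto
  then obtain k where "k \<in> A \<and> k \<notin> B" by blast
  from arg_min_nat_lemma[of "\<lambda>p. p \<in> A \<and> p \<notin> B", OF this, of rk] show thesis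
    by (auto intro: that)
qed

text \<open>Stating the length with an addition makes \<open>R\<close> finite with at least two
  elements and avoids truncated subtraction.\<close>

definition prufer_codes :: "'v set \<Rightarrow> 'v list set" where
  "prufer_codes R = {S. length S + 2 = card R \<and> set S \<subseteq> R}"

lemma prufer_codes_finite: "S \<in> prufer_codes R \<Longrightarrow> finite R"
  by (auto simp: prufer_codes_def intro: card_ge_0_finite)

text \<open>The code is shorter than the number of labels, so some label is missing from it. This
  packages one decoding step for the inductions on the code.\<close>

lemma prufer_codes_ConsE:
  assumes "s # S \<in> prufer_codes R" "inj_on rk R"
  obtains l where "l \<in> R" "l \<notin> set (s # S)" "\<And>p. \<lbrakk>p \<in> R; p \<notin> set (s # S)\<rbrakk> \<Longrightarrow> rk l \<le> rk p"
    "S \<in> prufer_codes (R - {l})" "inj_on rk (R - {l})" "s \<in> R"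
    "prufer_decode rk R (s # S) = insert {l, s} (prufer_decode rk (R - {l}) S)"
proof -
  have "card (set (s # S)) < card R"
    using assms(1) card_length[of "s # S"] by (simp add: prufer_codes_def)
  then obtain l where l: "l \<in> R" "l \<notin> set (s # S)"
    "\<And>p. \<lbrakk>p \<in> R; p \<notin> set (s # S)\<rbrakk> \<Longrightarrow> rk l \<le> rk p"
    using card_less_obtain_min[of "set (s # S)" R rk] by blast
  have "S \<in> prufer_codes (R - {l})"
    using assms(1) l prufer_codes_finite[OF assms(1)] by (auto simp: prufer_codes_def)
  moreover have "inj_on rk (R - {l})" using assms(2) by (rule inj_on_diff)
  moreover have "s \<in> R" using assms(1) by (simp add: prufer_codes_def)
  ultimately show thesis using that l prufer_decode_Cons[OF assms(2) l] by blast
qed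

text \<open>Read backwards, decoding attaches the leaf \<open>l\<close> to \<open>s\<close>: the
  degree of \<open>s\<close> grows by one for its occurrence at the head of the code, and
  \<open>l\<close> has degree 1 because it does not occur in the code.\<close>

lemma prufer_decode_tree:
  assumes "S \<in> prufer_codes R" "inj_on rk R"
  shows "prufer_decode rk R S \<in> spanning_trees R \<and> card (prufer_decode rk R S) = length S + 1 \<and>
    (\<forall>p\<in>R. vertex_degree (prufer_decode rk R S) p = 1 + count_list S p)"
  using assms
proof (induction S arbitrary: R)
  case Nil
  hence "card R = 2" by (simp add: prufer_codes_def)
  moreover have "{e. e = R \<and> p \<in> e} = {R}" if "p \<in> R" for p using that by auto
  ultimately show ?case
    by (simp add: prufer_decode_Nil spanning_tree_card_two vertex_degree_def)
next
  case (Cons s S)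
  obtain l where l: "l \<in> R" "l \<notin> set (s # S)" and S: "S \<in> prufer_codes (R - {l})"
    "inj_on rk (R - {l})" "s \<in> R"
    and eq: "prufer_decode rk R (s # S) = insert {l, s} (prufer_decode rk (R - {l}) S)"
    using prufer_codes_ConsE[OF Cons.prems] by metis
  define T where "T = prufer_decode rk (R - {l}) S"
  have T: "T \<in> spanning_trees (R - {l})" "card T = length S + 1"
    and deg: "\<And>p. p \<in> R - {l} \<Longrightarrow> vertex_degree T p = 1 + count_list S p"
    using Cons.IH[OF S(1,2)] by (auto simp: T_def)
  have TE: "T \<subseteq> complete_edges (R - {l})" using T by (simp add: spanning_trees_def)
  have finT: "finite T" using T(2) by (auto intro: card_ge_0_finite)
  have nl: "{l, s} \<notin> T" using TE complete_edgesD[of l s "R - {l}"] by auto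
  have "insert {l, s} T \<in> spanning_trees (insert l (R - {l}))"
    using l S(3) by (intro spanning_trees_insert_leaf T(1)) auto
  moreover have "insert l (R - {l}) = R" using l(1) by auto
  moreover have "card (insert {l, s} T) = length (s # S) + 1" using finT nl T(2) by simp
  moreover have "vertex_degree (insert {l, s} T) p = 1 + count_list (s # S) p" if p: "p \<in> R" for p
  proof (cases "p = l")
    case True
    have "{e \<in> T. l \<in> e} = {}" using TE by (auto simp: complete_edges_def)
    hence "vertex_degree T l = 0" by (simp only: vertex_degree_def card.empty)
    thus ?thesis using True l(2) by (auto simp: vertex_degree_insert[OF finT nl] count_list_0_iff)
  next
    case False
    thus ?thesis using p by (simp add: vertex_degree_insert[OF finT nl] deg)
  qed
  ultimately show ?case
    unfolding eq T_def[symmetric] by (intro conjI ballI) (simp_all only:)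
qed

lemma vertex_degree_eq_1_iff:
  assumes "E \<subseteq> complete_edges V"
  shows "vertex_degree E l = 1 \<longleftrightarrow> (\<exists>s. {e \<in> E. l \<in> e} = {{l, s}})"
proof
  assume "vertex_degree E l = 1"
  then obtain e where e: "{e \<in> E. l \<in> e} = {e}"
    unfolding vertex_degree_def by (auto simp: card_1_singleton_iff)
  hence "e \<in> complete_edges V" "l \<in> e" using assms by blast+
  thus "\<exists>s. {e \<in> E. l \<in> e} = {{l, s}}" by (metis complete_edges_memE e)
qed (auto simp: vertex_degree_def)

text \<open>The tree determines the degrees, hence the set of labels in the code, hence the first
  leaf removed. The only edge at that leaf gives the head of the code, and deleting the edge leaves
  a smaller instance.\<close>

lemma prufer_decode_inj:
  assumes "inj_on rk R" "S \<in> prufer_codes R" "S' \<in> prufer_codes R"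
    and "prufer_decode rk R S = prufer_decode rk R S'"
  shows "S = S'"
  using assms
proof (induction S arbitrary: R S')
  case Nil
  have "card R = 2" using Nil.prems(2) by (simp add: prufer_codes_def)
  moreover have "length S' + 2 = card R" using Nil.prems(3) by (simp add: prufer_codes_def)
  ultimately have "length S' = 0" by linarith
  thus ?case by simp
next
  case (Cons s S)
  obtain s' U where S': "S' = s' # U" using Cons.prems by (cases S') (auto simp: prufer_codes_def)
  obtain l where l: "l \<in> R" "l \<notin> set (s # S)" "\<And>p. \<lbrakk>p \<in> R; p \<notin> set (s # S)\<rbrakk> \<Longrightarrow> rk l \<le> rk p"
    and S: "S \<in> prufer_codes (R - {l})" "inj_on rk (R - {l})" "s \<in> R"
    and eq: "prufer_decode rk R (s # S) = insert {l, s} (prufer_decode rk (R - {l}) S)"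
    using prufer_codes_ConsE[OF Cons.prems(2,1)] by metis
  obtain l' where l': "l' \<in> R" "l' \<notin> set S'" "\<And>p. \<lbrakk>p \<in> R; p \<notin> set S'\<rbrakk> \<Longrightarrow> rk l' \<le> rk p"
    and U: "U \<in> prufer_codes (R - {l'})" "s' \<in> R"
    and eq': "prufer_decode rk R S' = insert {l', s'} (prufer_decode rk (R - {l'}) U)"
    using prufer_codes_ConsE[OF Cons.prems(3)[unfolded S'] Cons.prems(1)] unfolding S' by metis
  have "count_list (s # S) p = count_list S' p" if "p \<in> R" for p
    using that prufer_decode_tree[OF Cons.prems(2,1)] prufer_decode_tree[OF Cons.prems(3,1)]
      Cons.prems(4) by (metis add_left_cancel)
  hence "p \<in> set (s # S) \<longleftrightarrow> p \<in> set S'" if "p \<in> R" for p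
    using that by (metis count_list_0_iff)
  hence "rk l = rk l'" using l l' by (intro le_antisym) auto
  hence ll: "l' = l" using l(1) l'(1) by (metis Cons.prems(1) inj_onD)
  \<comment> \<open>The remaining tree has no edge at \<open>l\<close>, so on both sides the
    inserted edge is the one containing \<open>l\<close>.\<close>
  have no: "{l, x} \<notin> prufer_decode rk (R - {l}) W" if "W \<in> prufer_codes (R - {l})" for W x
    using prufer_decode_tree[OF that S(2)] complete_edgesD[of l x "R - {l}"]
    by (auto simp: spanning_trees_def)
  note no_S = no[OF S(1)] and no_U = no[OF U(1)[unfolded ll]]
  have e: "insert {l, s} (prufer_decode rk (R - {l}) S) = insert {l, s'} (prufer_decode rk (R - {l}) U)"
    using Cons.prems(4) eq eq' ll by simp
  have "{l, s} = {l, s'}" using e no_U by (metis insertE insertI1)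
  hence ss: "s = s'" by (auto simp: doubleton_eq_iff)
  have "prufer_decode rk (R - {l}) S = prufer_decode rk (R - {l}) U"
    using e no_S no_U unfolding ss by (metis insert_ident)
  hence "S = U" using Cons.IH[OF S(2) S(1)] U(1) ll by simp
  thus ?case by (simp add: S' ss)
qed

text \<open>This is the encoder: remove the smallest leaf \<open>l\<close> of the tree and record
  its neighbour \<open>s\<close>. The decoder removes the same \<open>l\<close>, because a label
  missing from \<open>s # S\<close> is either \<open>l\<close> or another leaf of
  \<open>T\<close>.\<close>

lemma prufer_decode_surj:
  assumes "inj_on rk R" "T \<in> spanning_trees R" "card R = n + 2"
  shows "\<exists>S\<in>prufer_codes R. T = prufer_decode rk R S"
  using assms
proof (induction n arbitrary: R T)
  case 0
  thus ?case using spanning_tree_card_two[of R]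
    by (intro bexI[of _ "[]"]) (auto simp: prufer_decode_Nil prufer_codes_def)
next
  case (Suc n)
  have fin: "finite R" using Suc.prems(3) by (auto intro: card_ge_0_finite)
  have TE: "T \<subseteq> complete_edges R" using Suc.prems by (simp add: spanning_trees_def)
  have finT: "finite T" using spanning_trees_finite Suc.prems(2) fin by blast
  note leaf = vertex_degree_eq_1_iff[OF TE]
  obtain l0 s0 where l0: "{e \<in> T. l0 \<in> e} = {{l0, s0}}"
    using spanning_trees_leaf_exists[OF Suc.prems(2) fin] Suc.prems(3) by auto
  hence "{l0, s0} \<in> complete_edges R" using TE by blast
  hence "l0 \<in> R" by (auto dest: complete_edgesD)
  hence "l0 \<in> R \<and> vertex_degree T l0 = 1" using l0 leaf by blast
  from arg_min_nat_lemma[of "\<lambda>p. p \<in> R \<and> vertex_degree T p = 1", OF this, of rk]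
  obtain l where l: "l \<in> R" "vertex_degree T l = 1"
    and min: "\<And>p. \<lbrakk>p \<in> R; vertex_degree T p = 1\<rbrakk> \<Longrightarrow> rk l \<le> rk p" by blast
  obtain s where s: "{e \<in> T. l \<in> e} = {{l, s}}" using l(2) leaf by blast
  hence ls: "{l, s} \<in> T" by blast
  hence sR: "s \<in> R" "l \<noteq> s" using TE complete_edgesD[of l s R] by auto
  let ?T = "T - {{l, s}}"
  have T': "?T \<in> spanning_trees (R - {l})" by (rule spanning_trees_remove_leaf[OF Suc.prems(2) s])
  have inj: "inj_on rk (R - {l})" using Suc.prems(1) by (rule inj_on_diff)
  obtain S where S: "S \<in> prufer_codes (R - {l})" "?T = prufer_decode rk (R - {l}) S"
    using Suc.IH[OF inj T'] l(1) fin Suc.prems(3) by auto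
  have deg: "vertex_degree T p = 1 + count_list (s # S) p" if "p \<in> R" "p \<noteq> l" for p
  proof -
    have "vertex_degree T p = vertex_degree (insert {l, s} ?T) p" using ls by (simp add: insert_absorb)
    also have "\<dots> = vertex_degree ?T p + of_bool (p = s)" using finT that by (subst vertex_degree_insert) auto
    also have "vertex_degree ?T p = 1 + count_list S p"
      using prufer_decode_tree[OF S(1) inj] that unfolding S(2) by simp
    finally show ?thesis by simp
  qed
  have lS: "l \<notin> set (s # S)" using S(1) sR by (auto simp: prufer_codes_def)
  have "rk l \<le> rk p" if "p \<in> R" "p \<notin> set (s # S)" for p
    using min[of p] deg[of p] that by (cases "p = l") (auto simp: count_list_0_iff)
  hence "prufer_decode rk R (s # S) = insert {l, s} ?T"
    unfolding S(2) by (intro prufer_decode_Cons Suc.prems(1) l(1) lS)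
  hence "T = prufer_decode rk R (s # S)" using ls by (simp add: insert_absorb)
  moreover have "s # S \<in> prufer_codes R"
    using S(1) sR l(1) fin by (auto simp: prufer_codes_def)
  ultimately show ?case by blast
qed

text \<open>The degrees of the decoded tree turn the product over its edges into a product over the
  code.\<close>

lemma prod_edges_eq_prod_degree:
  fixes c :: "'v \<Rightarrow> 'b::comm_monoid_mult"
  assumes "finite V" "E \<subseteq> complete_edges V"
  shows "(\<Prod>e\<in>E. \<Prod>p\<in>e. c p) = (\<Prod>p\<in>V. c p ^ vertex_degree E p)"
proof -
  have fE: "finite E" using assms finite_complete_edges finite_subset by blast
  have "(\<Prod>e\<in>E. \<Prod>p\<in>e. c p) = (\<Prod>e\<in>E. \<Prod>p\<in>V. if p \<in> e then c p else 1)"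
  proof (rule prod.cong)
    fix e assume "e \<in> E"
    hence "e \<subseteq> V" using assms(2) by (auto simp: complete_edges_def)
    thus "(\<Prod>p\<in>e. c p) = (\<Prod>p\<in>V. if p \<in> e then c p else 1)"
      using assms(1) by (simp add: prod.If_cases Int_absorb1)
  qed simp
  also have "\<dots> = (\<Prod>p\<in>V. \<Prod>e\<in>E. if p \<in> e then c p else 1)" by (rule prod.swap)
  also have "\<dots> = (\<Prod>p\<in>V. c p ^ vertex_degree E p)"
    using fE by (simp add: prod.If_cases vertex_degree_def Int_def)
  finally show ?thesis .
qed

lemma prod_list_eq_prod_count:
  fixes c :: "'v \<Rightarrow> 'b::comm_monoid_mult"
  assumes "finite V" "set S \<subseteq> V"
  shows "(\<Prod>p\<leftarrow>S. c p) = (\<Prod>p\<in>V. c p ^ count_list S p)"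
  using assms(2)
proof (induction S)
  case (Cons s S)
  have "c p ^ count_list (s # S) p = (if p = s then c p else 1) * c p ^ count_list S p" for p by simp
  thus ?case using Cons assms(1) by (simp add: prod.distrib del: count_list.simps)
qed simp

text \<open>The distributive law, read as expanding the power into words of length
  \<open>n\<close>.\<close>

lemma sum_prod_list_eq_power:
  fixes c :: "'v \<Rightarrow> 'b::comm_semiring_1"
  assumes "finite V"
  shows "(\<Sum>S | length S = n \<and> set S \<subseteq> V. \<Prod>p\<leftarrow>S. c p) = (\<Sum>p\<in>V. c p) ^ n"
proof (induction n)
  case 0
  have "{S::'v list. length S = 0 \<and> set S \<subseteq> V} = {[]}" by auto
  thus ?case by simp
next
  case (Suc n)
  have eq: "{S. length S = Suc n \<and> set S \<subseteq> V} =
      (\<lambda>(s, S). s # S) ` (V \<times> {S. length S = n \<and> set S \<subseteq> V})"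
    by (auto simp: length_Suc_conv image_iff)
  have "(\<Sum>S | length S = Suc n \<and> set S \<subseteq> V. \<Prod>p\<leftarrow>S. c p) =
      (\<Sum>(s, S) \<in> V \<times> {S. length S = n \<and> set S \<subseteq> V}. c s * (\<Prod>p\<leftarrow>S. c p))"
    unfolding eq by (subst sum.reindex) (auto simp: inj_on_def case_prod_unfold)
  also have "\<dots> = (\<Sum>p\<in>V. c p) * (\<Sum>S | length S = n \<and> set S \<subseteq> V. \<Prod>p\<leftarrow>S. c p)"
    by (simp add: sum.cartesian_product[symmetric] sum_product)
  finally show ?case by (simp add: Suc.IH)
qed

lemma prod_list_divide:
  "(\<Prod>p\<leftarrow>S. c p) / A ^ length S = (\<Prod>p\<leftarrow>S. c p / (A::'b::field))"
proof (induction S)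
  case (Cons s S)
  have "(\<Prod>p\<leftarrow>s # S. c p) / A ^ length (s # S) = c s / A * ((\<Prod>p\<leftarrow>S. c p) / A ^ length S)"
    by simp
  thus ?case unfolding Cons by simp
qed simp

text \<open>Each vertex occurs once more in the edge product than in the code, so the weight of a
  tree is that of its code times a common \<open>K\<close>, which cancels. The normalising sum is a
  weighted Cayley formula.\<close>

lemma rst_prob_prufer_decode:
  fixes c :: "'v \<Rightarrow> real"
  assumes S: "S \<in> prufer_codes V" and inj: "inj_on rk V" and A: "A > 0"
    and c: "\<And>p. p \<in> V \<Longrightarrow> c p > 0" and w: "\<And>e. w e = (\<Prod>p\<in>e. c p) / A"
  shows "rst_prob V w (prufer_decode rk V S) = (\<Prod>p\<leftarrow>S. c p / (\<Sum>p\<in>V. c p))"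
proof -
  define n where "n = length S"
  \<comment> \<open>One conductance for each vertex, and one \<open>1 / A\<close> for each of the
    \<open>n + 1\<close> edges.\<close>
  define K where "K = (\<Prod>p\<in>V. c p) / A ^ Suc n"
  have fin: "finite V" using prufer_codes_finite[OF S] .
  have V: "card V = n + 2" using S by (simp add: prufer_codes_def n_def)
  have weight: "(\<Prod>e\<in>prufer_decode rk V U. w e) = K * (\<Prod>p\<leftarrow>U. c p)"
    if U: "U \<in> prufer_codes V" for U
  proof -
    have len: "length U = n" using U V by (simp add: prufer_codes_def)
    let ?T = "prufer_decode rk V U"
    have T: "?T \<subseteq> complete_edges V" "card ?T = Suc n"
      "\<And>p. p \<in> V \<Longrightarrow> vertex_degree ?T p = 1 + count_list U p"
      using prufer_decode_tree[OF U inj] by (auto simp: spanning_trees_def len)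
    have "(\<Prod>e\<in>?T. w e) = (\<Prod>e\<in>?T. \<Prod>p\<in>e. c p) / A ^ Suc n"
      by (simp add: w prod_dividef T(2))
    also have "(\<Prod>e\<in>?T. \<Prod>p\<in>e. c p) = (\<Prod>p\<in>V. c p * c p ^ count_list U p)"
      by (simp add: prod_edges_eq_prod_degree[OF fin T(1)] T(3))
    also have "\<dots> = (\<Prod>p\<in>V. c p) * (\<Prod>p\<leftarrow>U. c p)"
      using U by (simp add: prod.distrib prod_list_eq_prod_count[OF fin] prufer_codes_def)
    finally show ?thesis by (simp add: K_def)
  qed
  have "bij_betw (prufer_decode rk V) (prufer_codes V) (spanning_trees V)"
    using prufer_decode_inj[OF inj] prufer_decode_surj[OF inj _ V] prufer_decode_tree[OF _ inj]
    unfolding bij_betw_def inj_on_def image_def by blast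
  hence "(\<Sum>T\<in>spanning_trees V. \<Prod>e\<in>T. w e) = (\<Sum>U\<in>prufer_codes V. \<Prod>e\<in>prufer_decode rk V U. w e)"
    by (rule sum.reindex_bij_betw[symmetric])
  also have "\<dots> = K * (\<Sum>U\<in>prufer_codes V. \<Prod>p\<leftarrow>U. c p)"
    by (simp add: weight sum_distrib_left)
  also have "prufer_codes V = {U. length U = n \<and> set U \<subseteq> V}"
    by (simp add: prufer_codes_def V)
  finally have total: "(\<Sum>T\<in>spanning_trees V. \<Prod>e\<in>T. w e) = K * (\<Sum>p\<in>V. c p) ^ n"
    by (simp add: sum_prod_list_eq_power[OF fin])
  have "K > 0" unfolding K_def using A c by (intro divide_pos_pos prod_pos) auto
  hence "rst_prob V w (prufer_decode rk V S) = (\<Prod>p\<leftarrow>S. c p) / (\<Sum>p\<in>V. c p) ^ length S"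
    by (simp add: rst_prob_def total weight[OF S] n_def)
  also have "\<dots> = (\<Prod>p\<leftarrow>S. c p / (\<Sum>p\<in>V. c p))" by (rule prod_list_divide)
  finally show ?thesis .
qed

section \<open>Reasoning about programs\<close>

text \<open>Asking for a final state builds in termination. As \<open>exec\<close> is deterministic,
  this also describes the only run, so the rules below are equations and can be used for
  rewriting.\<close>

definition wp :: "(nat \<Rightarrow> real) \<Rightarrow> com \<Rightarrow> state \<Rightarrow> (state \<Rightarrow> bool) \<Rightarrow> bool" where
  "wp \<omega> c s Q \<longleftrightarrow> (\<exists>t. exec \<omega> c s t \<and> Q t)"

lemma wp_iff: "exec \<omega> c s t \<Longrightarrow> wp \<omega> c s Q \<longleftrightarrow> Q t"
  unfolding wp_def using exec_deterministic by blast

lemmas wp_basic = exec.Skip[THEN wp_iff] exec.NSet[THEN wp_iff] exec.RSet[THEN wp_iff]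
  exec.NStore[THEN wp_iff] exec.RStore[THEN wp_iff] exec.DrawReal[THEN wp_iff]
  exec.DrawNat[THEN wp_iff]

lemma wp_Seq: "wp \<omega> (c ;; c') s Q \<longleftrightarrow> wp \<omega> c s (\<lambda>t. wp \<omega> c' t Q)"
  unfolding wp_def by (meson exec.Seq exec_SeqE)

lemma wp_If: "wp \<omega> (IF b THEN c ELSE c') s Q \<longleftrightarrow>
    (if bval b s then wp \<omega> c (charge (1 + bcost b) (brops b) s) Q
     else wp \<omega> c' (charge (1 + bcost b) (brops b) s) Q)"
  unfolding wp_def
  by (auto intro: exec.IfTrue[simplified] exec.IfFalse[simplified] elim!: exec_IfE)

lemmas wp_simps = wp_basic wp_Seq wp_If

lemma wp_mono: "wp \<omega> c s P \<Longrightarrow> (\<And>t. exec \<omega> c s t \<Longrightarrow> P t \<Longrightarrow> Q t) \<Longrightarrow> wp \<omega> c s Q"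
  unfolding wp_def by blast

text \<open>The counters are part of the state, so \<open>I\<close> can bound the running time along
  with the values. The failing last test is charged as well, hence the charged state in
  \<open>exit\<close>.\<close>

lemma wp_While:
  fixes f :: "state \<Rightarrow> nat"
  assumes "I s"
    and body: "\<And>s. \<lbrakk>I s; bval b s\<rbrakk> \<Longrightarrow>
      wp \<omega> c (charge (1 + bcost b) (brops b) s) (\<lambda>t. I t \<and> f t < f s)"
    and exit: "\<And>s. \<lbrakk>I s; \<not> bval b s\<rbrakk> \<Longrightarrow> Q (charge (1 + bcost b) (brops b) s)"
  shows "wp \<omega> (WHILE b DO c) s Q"
  using assms(1)
proof (induction "f s" arbitrary: s rule: less_induct)
  case less
  show ?case
  proof (cases "bval b s")
    case True
    obtain t where t: "exec \<omega> c (charge (1 + bcost b) (brops b) s) t" "I t" "f t < f s"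
      using body[OF less.prems True] by (auto simp: wp_def)
    then obtain u where "exec \<omega> (WHILE b DO c) t u" "Q u"
      using less.hyps by (auto simp: wp_def)
    thus ?thesis using exec.WhileTrue[OF True t(1)] by (auto simp: wp_def)
  next
    case False
    thus ?thesis using exec.WhileFalse[OF False] exit[OF less.prems False] by (auto simp: wp_def)
  qed
qed

text \<open>\<open>Tape\<close> stands for the position on the tape, written by every draw.\<close>

datatype loc = NReg string | RReg string | NArr string | RArr string | Tape

primrec writes :: "com \<Rightarrow> loc set" where
  "writes SKIP = {}"
| "writes (x :=\<^sub>n e) = {NReg x}"
| "writes (x :=\<^sub>r e) = {RReg x}"
| "writes (x\<lparr>i\<rparr> :=\<^sub>n e) = {NArr x}"
| "writes (x\<lparr>i\<rparr> :=\<^sub>r e) = {RArr x}"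
| "writes (DrawReal x) = {RReg x, Tape}"
| "writes (DrawNat x e) = {NReg x, Tape}"
| "writes (c ;; c') = writes c \<union> writes c'"
| "writes (IF b THEN c ELSE c') = writes c \<union> writes c'"
| "writes (WHILE b DO c) = writes c"

text \<open>With this, the lemma about a loop need only mention what the loop computes; that other
  variables are unchanged is read off the syntax.\<close>

lemma exec_frame:
  assumes "exec \<omega> c s t"
  shows "NReg x \<notin> writes c \<Longrightarrow> nreg t x = nreg s x"
    and "RReg x \<notin> writes c \<Longrightarrow> rreg t x = rreg s x"
    and "NArr x \<notin> writes c \<Longrightarrow> narr t x = narr s x"
    and "RArr x \<notin> writes c \<Longrightarrow> rarr t x = rarr s x"
    and "Tape \<notin> writes c \<Longrightarrow> tape_pos t = tape_pos s"
  using assms by (induction rule: exec.induct) (auto simp: charge_def)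

text \<open>Only draws read the tape. This is what gives all tapes the same alias table.\<close>

lemma exec_drawless: "exec \<omega> c s t \<Longrightarrow> Tape \<notin> writes c \<Longrightarrow> exec \<omega>' c s t"
  by (induction rule: exec.induct) (auto intro: exec.intros simp del: add_Suc add_Suc_right One_nat_def plus_nat.simps plus_1_eq_Suc)

lemma charge_sel [simp]:
  "nreg (charge k w s) = nreg s" "rreg (charge k w s) = rreg s"
  "narr (charge k w s) = narr s" "rarr (charge k w s) = rarr s"
  "tape_pos (charge k w s) = tape_pos s"
  "steps (charge k w s) = steps s + k" "real_work (charge k w s) = real_work s + w"
  by (simp_all add: charge_def)

lemma wp_incr: "wp \<omega> (incr x) s Q \<longleftrightarrow>
    Q ((charge 4 0 s)\<lparr>nreg := (nreg s)(x := Suc (nreg s x))\<rparr>)"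
  by (simp add: incr_def wp_simps eval_nat_numeral)

section \<open>The alias table\<close>

text \<open>The order of the entries is irrelevant to the construction, so a stack is abstracted to
  a set. Injectivity ensures that a popped column does not remain elsewhere on the stack.\<close>

definition is_stack :: "(nat \<Rightarrow> nat) \<Rightarrow> nat \<Rightarrow> nat set \<Rightarrow> bool" where
  "is_stack y h A \<longleftrightarrow> bij_betw y {..<h} A"

lemma is_stack_0 [simp]: "is_stack y 0 A \<longleftrightarrow> A = {}"
  by (auto simp: is_stack_def bij_betw_def)

lemma is_stack_push: "is_stack y h A \<Longrightarrow> x \<notin> A \<Longrightarrow> is_stack (y(h := x)) (Suc h) (insert x A)"
  by (auto simp: is_stack_def bij_betw_def inj_on_def lessThan_Suc)

lemma is_stack_pop:
  assumes "is_stack y h A" "0 < h"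
  shows "y (h - 1) \<in> A" "is_stack y (h - 1) (A - {y (h - 1)})"
proof -
  obtain k where h: "h = Suc k" using assms(2) by (cases h) auto
  have inj: "inj_on y {..<k}" and yk: "y k \<notin> y ` {..<k}" and A: "A = insert (y k) (y ` {..<k})"
    using assms(1) by (auto simp: h is_stack_def bij_betw_def lessThan_Suc)
  have "y ` {..<k} = A - {y k}" unfolding A using yk by simp
  thus "is_stack y (h - 1) (A - {y (h - 1)})"
    using inj by (simp add: h is_stack_def bij_betw_def)
  show "y (h - 1) \<in> A" unfolding A by (simp add: h)
qed

text \<open>Column \<open>j\<close> of the table yields \<open>i\<close> with probability \<open>p j\<close> if \<open>j = i\<close>, plus \<open>1 - p j\<close> if
  \<open>al j = i\<close>; \<open>w i\<close> is the sum of these over the columns.\<close>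

definition alias_table :: "nat \<Rightarrow> (nat \<Rightarrow> real) \<Rightarrow> (nat \<Rightarrow> real) \<Rightarrow> (nat \<Rightarrow> nat) \<Rightarrow> bool" where
  "alias_table d w p al \<longleftrightarrow> (\<forall>j<d. 0 \<le> p j \<and> p j \<le> 1 \<and> al j < d) \<and>
     (\<forall>i<d. p i + (\<Sum>j<d. if al j = i then 1 - p j else 0) = w i)"

text \<open>\<open>A\<close> and \<open>B\<close> are the columns on the stacks of underfull and overfull columns; the columns in
  neither of them are final.\<close>

definition vose_inv :: "nat \<Rightarrow> (nat \<Rightarrow> real) \<Rightarrow> (nat \<Rightarrow> real) \<Rightarrow> (nat \<Rightarrow> nat) \<Rightarrow> nat set \<Rightarrow> nat set \<Rightarrow> bool" where
  "vose_inv d w p al A B \<longleftrightarrow> A \<inter> B = {} \<and> A \<union> B \<subseteq> {..<d} \<and> (\<forall>i<d. 0 \<le> p i \<and> al i < d) \<and>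
     (\<forall>i\<in>A. p i < 1) \<and> (\<forall>i\<in>B. 1 \<le> p i) \<and> (\<forall>i\<in>A \<union> B. al i = i) \<and>
     (\<forall>i<d. i \<notin> A \<union> B \<longrightarrow> p i \<le> 1) \<and> (\<Sum>i\<in>A \<union> B. p i) = card (A \<union> B) \<and>
     (\<forall>i<d. p i + (\<Sum>j\<in>{..<d} - (A \<union> B). if al j = i then 1 - p j else 0) = w i)"

text \<open>Column \<open>s\<close> becomes final and now yields \<open>l\<close> with probability
  \<open>1 - p s\<close>; column \<open>l\<close> gives up the same amount, so the yield of
  \<open>l\<close> is unchanged. Mass and number of the stacked columns both drop by 1.\<close>

lemma vose_inv_step:
  assumes inv: "vose_inv d w p al A B" and s: "s \<in> A" and l: "l \<in> B"
  defines "p' \<equiv> p(l := p l - (1 - p s))" and "al' \<equiv> al(s := l)"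
  shows "p l - (1 - p s) < 1 \<Longrightarrow> vose_inv d w p' al' (insert l (A - {s})) (B - {l})"
    and "\<not> p l - (1 - p s) < 1 \<Longrightarrow> vose_inv d w p' al' (A - {s}) (insert l (B - {l}))"
proof -
  let ?U = "A \<union> B"
  have disj: "A \<inter> B = {}" and sub: "?U \<subseteq> {..<d}" and p0: "\<And>i. i < d \<Longrightarrow> 0 \<le> p i \<and> al i < d"
    and pA: "\<And>i. i \<in> A \<Longrightarrow> p i < 1" and pB: "\<And>i. i \<in> B \<Longrightarrow> 1 \<le> p i"
    and alU: "\<And>i. i \<in> A \<union> B \<Longrightarrow> al i = i" and pF: "\<And>i. i < d \<Longrightarrow> i \<notin> A \<union> B \<Longrightarrow> p i \<le> 1"
    and sum: "(\<Sum>i\<in>?U. p i) = card ?U"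
    and mass: "\<And>i. i < d \<Longrightarrow> p i + (\<Sum>j\<in>{..<d} - ?U. if al j = i then 1 - p j else 0) = w i"
    using inv unfolding vose_inv_def by auto
  have fin: "finite ?U" using sub finite_subset by blast
  have sl: "s \<noteq> l" "s < d" "l < d" using s l disj sub by auto
  \<comment> \<open>The union of the two stacks afterwards, whichever of them receives
    \<open>l\<close>; all but the comparison with 1 is therefore shared by both conclusions.\<close>
  let ?V = "?U - {s}"
  have "(\<Sum>i\<in>?V. p' i) = p' l + (\<Sum>i\<in>?V - {l}. p' i)"
    using fin l sl by (intro sum.remove) auto
  also have "(\<Sum>i\<in>?V - {l}. p' i) = (\<Sum>i\<in>?V - {l}. p i)" by (simp add: p'_def)
  also have "p' l + \<dots> = (p l + (\<Sum>i\<in>?V - {l}. p i)) + p s - 1" by (simp add: p'_def)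
  also have "p l + (\<Sum>i\<in>?V - {l}. p i) = (\<Sum>i\<in>?V. p i)"
    using fin l sl by (intro sum.remove[symmetric]) auto
  also have "(\<Sum>i\<in>?V. p i) + p s = (\<Sum>i\<in>?U. p i)" using fin s by (subst sum.remove[of ?U s]) auto
  also have "(\<Sum>i\<in>?U. p i) - 1 = card ?V"
  proof -
    have "Suc (card ?V) = card ?U" using fin s by (intro card_Suc_Diff1) auto
    thus ?thesis unfolding sum by linarith
  qed
  finally have sum': "(\<Sum>i\<in>?V. p' i) = card ?V" .
  have F: "{..<d} - ?V = insert s ({..<d} - ?U)" using s sl by auto
  have mass': "p' i + (\<Sum>j\<in>{..<d} - ?V. if al' j = i then 1 - p' j else 0) = w i" if i: "i < d" for i
  proof -
    have "(\<Sum>j\<in>{..<d} - ?V. if al' j = i then 1 - p' j else 0) =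
        (if l = i then 1 - p s else 0) + (\<Sum>j\<in>{..<d} - ?U. if al' j = i then 1 - p' j else 0)"
      unfolding F using s sl by (subst sum.insert) (auto simp: al'_def p'_def)
    also have "(\<Sum>j\<in>{..<d} - ?U. if al' j = i then 1 - p' j else 0) =
        (\<Sum>j\<in>{..<d} - ?U. if al j = i then 1 - p j else 0)"
      using s l by (intro sum.cong) (auto simp: al'_def p'_def)
    finally show ?thesis using mass[OF i] by (auto simp: p'_def)
  qed
  \<comment> \<open>An overfull column can always fill the gap, which is at most 1.\<close>
  have "0 \<le> p l - (1 - p s)" using pB[OF l] p0[OF sl(2)] by linarith
  hence p0': "\<forall>i<d. 0 \<le> p' i \<and> al' i < d"
    using p0 sl by (simp add: p'_def al'_def)
  have al': "\<forall>i\<in>?V. al' i = i" using alU by (auto simp: al'_def)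
  have pF': "\<forall>i<d. i \<notin> ?V \<longrightarrow> p' i \<le> 1" using pF pA[OF s] l sl by (auto simp: p'_def)
  show "vose_inv d w p' al' (insert l (A - {s})) (B - {l})" if lt: "p l - (1 - p s) < 1"
  proof -
    have V: "insert l (A - {s}) \<union> (B - {l}) = ?V" using l s disj by auto
    have "\<forall>i\<in>insert l (A - {s}). p' i < 1" "\<forall>i\<in>B - {l}. 1 \<le> p' i"
      using lt pA pB by (auto simp: p'_def)
    thus ?thesis unfolding vose_inv_def V
      using disj sub sum' mass' p0' al' pF' by auto
  qed
  show "vose_inv d w p' al' (A - {s}) (insert l (B - {l}))" if lt: "\<not> p l - (1 - p s) < 1"
  proof -
    have V: "(A - {s}) \<union> insert l (B - {l}) = ?V" using l s disj by auto
    have "\<forall>i\<in>A - {s}. p' i < 1" "\<forall>i\<in>insert l (B - {l}). 1 \<le> p' i"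
      using lt pA pB disj l by (auto simp: p'_def)
    thus ?thesis unfolding vose_inv_def V
      using disj sub sum' mass' p0' al' pF' l by auto
  qed
qed

lemma sum_eq_card_imp_eq_1:
  fixes p :: "'a \<Rightarrow> real"
  assumes "finite U" "(\<Sum>i\<in>U. p i) = card U" and "(\<forall>i\<in>U. p i \<le> 1) \<or> (\<forall>i\<in>U. 1 \<le> p i)"
  shows "\<forall>i\<in>U. p i = 1"
proof -
  have sum: "(\<Sum>i\<in>U. p i) = (\<Sum>i\<in>U. 1)" using assms(2) by simp
  show ?thesis
  proof (rule disjE[OF assms(3)])
    assume "\<forall>i\<in>U. p i \<le> 1"
    thus ?thesis using sum_mono_inv[OF sum] assms(1) by auto
  next
    assume "\<forall>i\<in>U. 1 \<le> p i"
    thus ?thesis using sum_mono_inv[OF sum[symmetric]] assms(1) by auto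
  qed
qed

text \<open>The total mass is exact, so the columns left over when one stack runs empty are exactly full.\<close>

lemma vose_inv_final:
  assumes inv: "vose_inv d w p al A B" and "A = {} \<or> B = {}"
  shows "alias_table d w p al"
proof -
  let ?U = "A \<union> B"
  have sub: "?U \<subseteq> {..<d}" and p0: "\<And>i. i < d \<Longrightarrow> 0 \<le> p i \<and> al i < d"
    and pU: "(\<forall>i\<in>?U. p i \<le> 1) \<or> (\<forall>i\<in>?U. 1 \<le> p i)"
    and pF: "\<And>i. i < d \<Longrightarrow> i \<notin> A \<union> B \<Longrightarrow> p i \<le> 1"
    and sum: "(\<Sum>i\<in>?U. p i) = card ?U"
    and mass: "\<And>i. i < d \<Longrightarrow> p i + (\<Sum>j\<in>{..<d} - ?U. if al j = i then 1 - p j else 0) = w i"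
    using inv assms(2) unfolding vose_inv_def by (auto simp: less_imp_le)
  have fin: "finite ?U" using sub finite_subset by blast
  have p1: "\<forall>i\<in>?U. p i = 1" by (rule sum_eq_card_imp_eq_1[OF fin sum pU])
  have "(\<Sum>j<d. if al j = i then 1 - p j else 0) =
      (\<Sum>j\<in>{..<d} - ?U. if al j = i then 1 - p j else 0)" for i
    by (rule sum.mono_neutral_right) (use p1 in auto)
  moreover have "p j \<le> 1" if "j < d" for j using pF[OF that] p1 by (cases "j \<in> ?U") auto
  ultimately show ?thesis using p0 mass by (simp add: alias_table_def)
qed

text \<open>At the start no column is final: the alias sums are empty and each mass is the column's
  own.\<close>

lemma vose_inv_init:
  fixes w p :: "nat \<Rightarrow> real"
  assumes "\<And>i. i < d \<Longrightarrow> 0 \<le> w i" "(\<Sum>i<d. w i) = d" "\<And>i. i < d \<Longrightarrow> p i = w i \<and> al i = i"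
  shows "vose_inv d w p al {i. i < d \<and> w i < 1} {i. i < d \<and> \<not> w i < 1}"
proof -
  have U: "{i. i < d \<and> w i < 1} \<union> {i. i < d \<and> \<not> w i < 1} = {..<d}" by auto
  have "(\<Sum>i<d. p i) = d" using assms by simp
  moreover have "{i. i < d \<and> w i < 1} \<inter> {i. i < d \<and> \<not> w i < 1} = {}" by auto
  ultimately show ?thesis unfolding vose_inv_def U
    by (intro conjI) (simp_all add: assms(1,3))
qed

section \<open>The loops that build the alias table\<close>

definition total_loop :: com where
  "total_loop =
    (WHILE NV ''i'' <\<^sub>n NV ''d'' DO (
      ''total'' :=\<^sub>r (RV ''total'' +\<^sub>r RAt ''a'' (NV ''i'')) ;;
      incr ''i''))"

definition fill_loop :: com where
  "fill_loop =
    (WHILE NV ''i'' <\<^sub>n NV ''d'' DO (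
      ''prob''\<lparr>NV ''i''\<rparr> :=\<^sub>r (ROf (NV ''d'') *\<^sub>r RAt ''a'' (NV ''i'') /\<^sub>r RV ''total'') ;;
      ''alias''\<lparr>NV ''i''\<rparr> :=\<^sub>n NV ''i'' ;;
      IF RAt ''prob'' (NV ''i'') <\<^sub>r RC 1
        THEN push ''small'' ''small_height'' ''i''
        ELSE push ''large'' ''large_height'' ''i'' ;;
      incr ''i''))"

definition vose_loop :: com where
  "vose_loop =
    (WHILE (NC 0 <\<^sub>n NV ''small_height'') &\<^sub>b (NC 0 <\<^sub>n NV ''large_height'') DO (
      pop ''small'' ''small_height'' ''s'' ;;
      pop ''large'' ''large_height'' ''l'' ;;
      ''alias''\<lparr>NV ''s''\<rparr> :=\<^sub>n NV ''l'' ;;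
      ''prob''\<lparr>NV ''l''\<rparr> :=\<^sub>r (RAt ''prob'' (NV ''l'') -\<^sub>r (RC 1 -\<^sub>r RAt ''prob'' (NV ''s''))) ;;
      IF RAt ''prob'' (NV ''l'') <\<^sub>r RC 1
        THEN push ''small'' ''small_height'' ''l''
        ELSE push ''large'' ''large_height'' ''l''))"

lemma build_alias_table_eq: "build_alias_table =
   (''total'' :=\<^sub>r RC 0 ;;
    ''i'' :=\<^sub>n NC 0 ;;
    total_loop ;;
    ''m'' :=\<^sub>n (NV ''rho'' *\<^sub>n NV ''d'') ;;
    ''small_height'' :=\<^sub>n NC 0 ;;
    ''large_height'' :=\<^sub>n NC 0 ;;
    ''i'' :=\<^sub>n NC 0 ;;
    fill_loop ;;
    vose_loop)"
  by (simp add: build_alias_table_def total_loop_def fill_loop_def vose_loop_def)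

text \<open>An iteration costs 4 for the test, 5 for the addition and 4 for the increment; the extra
  4 is the failing last test. The step bounds per iteration in later loops are rounded up.\<close>

lemma total_loop:
  assumes "nreg s ''i'' = 0" "rreg s ''total'' = 0"
  shows "wp \<omega> total_loop s (\<lambda>t. rreg t ''total'' = (\<Sum>i<nreg s ''d''. rarr s ''a'' i) \<and>
     steps t \<le> steps s + 13 * nreg s ''d'' + 4 \<and> real_work t \<le> real_work s + nreg s ''d'')"
  unfolding total_loop_def
proof (rule wp_While[where I = "\<lambda>t. nreg t ''i'' \<le> nreg s ''d'' \<and> nreg t ''d'' = nreg s ''d'' \<and>
      rarr t ''a'' = rarr s ''a'' \<and>
      rreg t ''total'' = (\<Sum>i<nreg t ''i''. rarr s ''a'' i) \<and>
      steps t \<le> steps s + 13 * nreg t ''i'' \<and> real_work t \<le> real_work s + nreg t ''i''"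
     and f = "\<lambda>t. nreg s ''d'' - nreg t ''i''"], goal_cases)
  case 1
  then show ?case using assms by simp
next
  case (2 t)
  then show ?case by (simp add: wp_simps wp_incr)
next
  case (3 t)
  then show ?case by simp
qed

lemma is_stack_push_if:
  assumes "is_stack y h {j. j < n \<and> P j}" "P n"
  shows "is_stack (y(h := n)) (Suc h) {j. j < Suc n \<and> P j}"
proof -
  have "{j. j < Suc n \<and> P j} = insert n {j. j < n \<and> P j}" using assms(2) by (auto simp: less_Suc_eq)
  thus ?thesis using is_stack_push[OF assms(1), of n] by simp
qed

lemma less_Suc_Collect_skip: "\<not> P n \<Longrightarrow> {j. j < Suc n \<and> P j} = {j. j < n \<and> P j}"
  by (auto simp: less_Suc_eq)

lemma fill_loop:
  assumes "nreg s ''i'' = 0" "nreg s ''small_height'' = 0" "nreg s ''large_height'' = 0"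
  defines "n \<equiv> nreg s ''d''"
  defines "w \<equiv> \<lambda>i. real n * rarr s ''a'' i / rreg s ''total''"
  shows "wp \<omega> fill_loop s (\<lambda>t. (\<forall>i<n. rarr t ''prob'' i = w i \<and> narr t ''alias'' i = i) \<and>
     is_stack (narr t ''small'') (nreg t ''small_height'') {i. i < n \<and> w i < 1} \<and>
     is_stack (narr t ''large'') (nreg t ''large_height'') {i. i < n \<and> \<not> w i < 1} \<and>
     nreg t ''small_height'' + nreg t ''large_height'' = n \<and>
     steps t \<le> steps s + 40 * n + 4 \<and> real_work t \<le> real_work s + 3 * n)"
  unfolding fill_loop_def
proof (rule wp_While[where I = "\<lambda>t. let k = nreg t ''i'' in k \<le> n \<and> nreg t ''d'' = n \<and>
      rarr t ''a'' = rarr s ''a'' \<and> rreg t ''total'' = rreg s ''total'' \<and>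
     (\<forall>i<k. rarr t ''prob'' i = w i \<and> narr t ''alias'' i = i) \<and>
     is_stack (narr t ''small'') (nreg t ''small_height'') {i. i < k \<and> w i < 1} \<and>
     is_stack (narr t ''large'') (nreg t ''large_height'') {i. i < k \<and> \<not> w i < 1} \<and>
     nreg t ''small_height'' + nreg t ''large_height'' = k \<and>
     steps t \<le> steps s + 40 * k \<and> real_work t \<le> real_work s + 3 * k"
     and f = "\<lambda>t. n - nreg t ''i''"], goal_cases)
  case 1
  then show ?case using assms by simp
next
  case (2 t)
  define k where "k = nreg t ''i''"
  have k: "k < n" "nreg t ''d'' = n" using 2 by (simp_all add: k_def Let_def)
  have wk: "w k = real n * rarr t ''a'' k / rreg t ''total''"
    using 2 by (simp add: Let_def w_def)
  have small: "is_stack (narr t ''small'') (nreg t ''small_height'') {i. i < k \<and> w i < 1}"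
    and large: "is_stack (narr t ''large'') (nreg t ''large_height'') {i. i < k \<and> \<not> w i < 1}"
    using 2 by (simp_all add: k_def Let_def)
  show ?case
  proof (cases "w k < 1")
    case True
    note small' = is_stack_push_if[OF small, OF True]
    have "{i. i < Suc k \<and> \<not> w i < 1} = {i. i < k \<and> \<not> w i < 1}"
      using True by (intro less_Suc_Collect_skip) simp
    note large' = large[folded this]
    show ?thesis using 2 k wk small' large' True
      by (simp add: wp_simps wp_incr push_def Let_def k_def[symmetric] All_less_Suc)
  next
    case False
    note large' = is_stack_push_if[OF large, OF False]
    have "{i. i < Suc k \<and> w i < 1} = {i. i < k \<and> w i < 1}"
      using False by (intro less_Suc_Collect_skip) simp
    note small' = small[folded this]
    show ?thesis using 2 k wk small' large' False
      by (simp add: wp_simps wp_incr push_def Let_def k_def[symmetric] All_less_Suc)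
  qed
next
  case (3 t)
  hence "nreg t ''i'' = n" by (simp add: Let_def)
  with 3 show ?case by (simp add: Let_def)
qed

text \<open>Each iteration pops two columns and pushes one, so the sum of the stack heights is both
  the termination measure and the potential that pays for the steps.\<close>

lemma vose_loop:
  assumes "vose_inv n w (rarr s ''prob'') (narr s ''alias'') A B"
    and "is_stack (narr s ''small'') (nreg s ''small_height'') A"
    and "is_stack (narr s ''large'') (nreg s ''large_height'') B"
    and "nreg s ''small_height'' + nreg s ''large_height'' = n"
  shows "wp \<omega> vose_loop s (\<lambda>t. alias_table n w (rarr t ''prob'') (narr t ''alias'') \<and>
     steps t \<le> steps s + 60 * n + 8 \<and> real_work t \<le> real_work s + 3 * n)"
  unfolding vose_loop_def
proof (rule wp_While[where I = "\<lambda>t. (\<exists>A B. vose_inv n w (rarr t ''prob'') (narr t ''alias'') A B \<and>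
      is_stack (narr t ''small'') (nreg t ''small_height'') A \<and>
      is_stack (narr t ''large'') (nreg t ''large_height'') B) \<and>
      nreg t ''small_height'' + nreg t ''large_height'' \<le> n \<and>
      steps t + 60 * (nreg t ''small_height'' + nreg t ''large_height'') \<le> steps s + 60 * n \<and>
      real_work t + 3 * (nreg t ''small_height'' + nreg t ''large_height'') \<le> real_work s + 3 * n"
     and f = "\<lambda>t. nreg t ''small_height'' + nreg t ''large_height''"], goal_cases)
  case 1
  then show ?case using assms by auto
next
  case (2 t)
  define hs where "hs = nreg t ''small_height'' - 1"
  define hl where "hl = nreg t ''large_height'' - 1"
  have h: "nreg t ''small_height'' = Suc hs" "nreg t ''large_height'' = Suc hl"
    using 2 by (simp_all add: hs_def hl_def)
  define l where "l = narr t ''large'' hl"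
  define j where "j = narr t ''small'' hs"
  obtain A B where AB: "vose_inv n w (rarr t ''prob'') (narr t ''alias'') A B"
      "is_stack (narr t ''small'') (Suc hs) A"
      "is_stack (narr t ''large'') (Suc hl) B" using 2 by (auto simp: h)
  have A: "j \<in> A" "is_stack (narr t ''small'') hs (A - {j})"
    using is_stack_pop[OF AB(2)] by (simp_all add: j_def)
  have B: "l \<in> B" "is_stack (narr t ''large'') hl (B - {l})"
    using is_stack_pop[OF AB(3)] by (simp_all add: l_def)
  have jl: "j \<noteq> l" "l \<notin> A" using AB(1) A(1) B(1) by (auto simp: vose_inv_def)
  note step = vose_inv_step[OF AB(1) A(1) B(1)]
  have costs: "steps t + 60 * (Suc hs + Suc hl) \<le> steps s + 60 * n"
    "real_work t + 3 * (Suc hs + Suc hl) \<le> real_work s + 3 * n" "Suc hs + Suc hl \<le> n"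
    using 2 h by auto
  show ?case
  proof (cases "rarr t ''prob'' l - (1 - rarr t ''prob'' j) < 1")
    case True
    have "is_stack ((narr t ''small'')(hs := l)) (Suc hs) (insert l (A - {j}))"
      using A(2) by (rule is_stack_push) (use jl in simp)
    with step(1)[OF True] B(2)
    have ex: "\<exists>A B. vose_inv n w ((rarr t ''prob'')(l := rarr t ''prob'' l - (1 - rarr t ''prob'' j)))
        ((narr t ''alias'')(j := l)) A B \<and>
        is_stack ((narr t ''small'')(hs := l)) (Suc hs) A \<and> is_stack (narr t ''large'') hl B" by blast
    show ?thesis using True jl costs ex
      by (simp add: wp_simps push_def pop_def incr_def h l_def[symmetric] j_def[symmetric])
  next
    case False
    have "is_stack ((narr t ''large'')(hl := l)) (Suc hl) (insert l (B - {l}))"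
      using B(2) by (rule is_stack_push) simp
    with step(2)[OF False] A(2)
    have ex: "\<exists>A B. vose_inv n w ((rarr t ''prob'')(l := rarr t ''prob'' l - (1 - rarr t ''prob'' j)))
        ((narr t ''alias'')(j := l)) A B \<and>
        is_stack (narr t ''small'') hs A \<and> is_stack ((narr t ''large'')(hl := l)) (Suc hl) B" by blast
    show ?thesis using False jl costs ex
      by (simp add: wp_simps push_def pop_def incr_def h l_def[symmetric] j_def[symmetric])
  qed
next
  case (3 t)
  then obtain A B where AB: "vose_inv n w (rarr t ''prob'') (narr t ''alias'') A B"
    "is_stack (narr t ''small'') (nreg t ''small_height'') A"
    "is_stack (narr t ''large'') (nreg t ''large_height'') B" by blast
  have "A = {} \<or> B = {}" using 3 AB by auto
  from vose_inv_final[OF AB(1) this] show ?case using 3 by simp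
qed

text \<open>The real work per column is 1 for the total, 3 for filling and 3 for levelling. In the
  step bound, \<open>d \<ge> 1\<close> absorbs the additive constants.\<close>

lemma build_alias_table:
  assumes d: "nreg s ''d'' = d" "d \<ge> 1" and a: "\<And>i. i < d \<Longrightarrow> 0 < rarr s ''a'' i"
  shows "wp \<omega> build_alias_table s (\<lambda>t.
     alias_table d (\<lambda>i. real d * rarr s ''a'' i / (\<Sum>i<d. rarr s ''a'' i))
       (rarr t ''prob'') (narr t ''alias'') \<and>
     nreg t ''m'' = nreg s ''rho'' * d \<and>
     steps t \<le> steps s + 200 * d \<and> real_work t \<le> real_work s + 7 * d)"
proof -
  let ?total = "\<Sum>i<d. rarr s ''a'' i"
  let ?w = "\<lambda>i. real d * rarr s ''a'' i / ?total"
  have pos: "?total > 0" using a d by (intro sum_pos) (auto simp: lessThan_empty_iff)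
  have w0: "0 \<le> ?w i" if "i < d" for i using a[OF that] pos by simp
  have wsum: "(\<Sum>i<d. ?w i) = d"
    using pos by (simp flip: sum_divide_distrib sum_distrib_left)
  show ?thesis
    unfolding build_alias_table_eq
    apply (simp add: wp_simps)
    apply (rule wp_mono[OF total_loop])
      apply simp
     apply simp
    apply (simp add: d)
    apply (frule exec_frame(1)[of _ _ _ _ "''d''"])
     apply (simp add: total_loop_def incr_def)
    apply (frule exec_frame(1)[of _ _ _ _ "''rho''"])
     apply (simp add: total_loop_def incr_def)
    apply (frule exec_frame(4)[of _ _ _ _ "''a''"])
     apply (simp add: total_loop_def incr_def)
    apply (rule wp_mono[OF fill_loop])
       apply simp
      apply simp
     apply simp
    apply (simp add: d)
    subgoal premises prems for t u
    proof -
      note u = prems(7)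
      have m: "nreg u ''m'' = nreg s ''rho'' * d"
        using exec_frame(1)[OF prems(6), of "''m''"] by (simp add: fill_loop_def incr_def push_def)
      have inv: "vose_inv d ?w (rarr u ''prob'') (narr u ''alias'') {i. i < d \<and> ?w i < 1} {i. i < d \<and> \<not> ?w i < 1}"
        using u by (intro vose_inv_init w0 wsum) auto
      show ?thesis
      proof (rule wp_mono[OF vose_loop[OF inv]], goal_cases)
        case (4 v)
        have "nreg v ''m'' = nreg u ''m''"
          using 4(1) by (rule exec_frame) (simp add: vose_loop_def incr_def push_def pop_def)
        then show ?case using 4(2) u prems(2) m d(2) by simp
      qed (use u in auto)
    qed
    done
qed

section \<open>Sampling and decoding\<close>

definition sample_entry :: "nat \<Rightarrow> nat \<Rightarrow> (nat \<Rightarrow> real) \<Rightarrow> (nat \<Rightarrow> nat) \<Rightarrow> real \<Rightarrow> real \<Rightarrow> real \<Rightarrow> nat" where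
  "sample_entry d \<rho> p al x y z =
     (let j = nat \<lfloor>real d * x\<rfloor> in if y < p j then j else al j) * \<rho> + nat \<lfloor>real \<rho> * z\<rfloor>"

text \<open>Either branch of the alias test consumes no further draw, so entry \<open>k\<close>
  starts at tape position \<open>3 * k\<close>. Comparing two stored reals adds no real
  work.\<close>

lemma sample_code:
  assumes "tape_pos s = 0"
  defines "n \<equiv> nreg s ''m'' - 2"
  shows "wp \<omega> sample_code s (\<lambda>t. (\<forall>k<n. narr t ''S'' k =
      sample_entry (nreg s ''d'') (nreg s ''rho'') (rarr s ''prob'') (narr s ''alias'')
        (\<omega> (3 * k)) (\<omega> (3 * k + 1)) (\<omega> (3 * k + 2))) \<and>
     steps t \<le> steps s + 60 * n + 10 \<and> real_work t = real_work s)"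
proof -
  define e where "e k = sample_entry (nreg s ''d'') (nreg s ''rho'') (rarr s ''prob'') (narr s ''alias'')
        (\<omega> (3 * k)) (\<omega> (3 * k + 1)) (\<omega> (3 * k + 2))" for k
  show ?thesis
    unfolding sample_code_def wp_Seq wp_basic e_def[symmetric]
  proof (rule wp_While[where I = "\<lambda>t. let k = nreg t ''t'' in k \<le> n \<and> tape_pos t = 3 * k \<and>
        nreg t ''m'' = nreg s ''m'' \<and> nreg t ''d'' = nreg s ''d'' \<and> nreg t ''rho'' = nreg s ''rho'' \<and>
        rarr t ''prob'' = rarr s ''prob'' \<and> narr t ''alias'' = narr s ''alias'' \<and>
        (\<forall>k'<k. narr t ''S'' k' = e k') \<and>
        steps t \<le> steps s + 2 + 60 * k \<and> real_work t = real_work s"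
     and f = "\<lambda>t. n - nreg t ''t''"], goal_cases)
    case 1
    then show ?case using assms by simp
  next
    case (2 t)
    define k where "k = nreg t ''t''"
    have k: "k < n" using 2 by (simp add: k_def Let_def n_def)
    define j where "j = nat \<lfloor>real (nreg s ''d'') * \<omega> (3 * k)\<rfloor>"
    have e: "e k = (if \<omega> (3 * k + 1) < rarr s ''prob'' j then j else narr s ''alias'' j) * nreg s ''rho'' +
        nat \<lfloor>real (nreg s ''rho'') * \<omega> (3 * k + 2)\<rfloor>"
      by (simp add: e_def sample_entry_def j_def Let_def)
    show ?case
    proof (cases "\<omega> (3 * k + 1) < rarr s ''prob'' j")
      case True
      then show ?thesis using 2 k e
        by (simp add: wp_simps wp_incr Let_def k_def[symmetric] j_def[symmetric] All_less_Suc)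
    next
      case False
      then show ?thesis using 2 k e
        by (simp add: wp_simps wp_incr Let_def k_def[symmetric] j_def[symmetric] All_less_Suc)
    qed
  next
    case (3 t)
    hence "nreg t ''t'' = n" by (simp add: Let_def n_def)
    with 3 show ?case by (simp add: Let_def)
  qed
qed

section \<open>The loops of the decoder\<close>

definition label_inner :: com where
  "label_inner =
    (WHILE NV ''k'' <\<^sub>n NV ''rho'' DO (
        ''phi''\<lparr>NV ''p''\<rparr> :=\<^sub>n NV ''i'' ;;
        ''r''\<lparr>NV ''p''\<rparr> :=\<^sub>n NC 1 ;;
        incr ''p'' ;;
        incr ''k''))"

definition label_loop :: com where
  "label_loop =
    (WHILE NV ''i'' <\<^sub>n NV ''d'' DO (
      ''k'' :=\<^sub>n NC 0 ;;
      label_inner ;;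
      incr ''i''))"

definition count_loop :: com where
  "count_loop =
    (WHILE NV ''t'' <\<^sub>n (NV ''m'' -\<^sub>n NC 2) DO (
      ''v'' :=\<^sub>n NAt ''S'' (NV ''t'') ;;
      ''r''\<lparr>NV ''v''\<rparr> :=\<^sub>n (NAt ''r'' (NV ''v'') +\<^sub>n NC 1) ;;
      incr ''t''))"

definition peel_loop :: com where
  "peel_loop =
    (WHILE NV ''t'' <\<^sub>n (NV ''m'' -\<^sub>n NC 2) DO (
      ''v'' :=\<^sub>n NAt ''S'' (NV ''t'') ;;
      ''U''\<lparr>NV ''t''\<rparr> :=\<^sub>n NV ''leaf'' ;;
      ''V''\<lparr>NV ''t''\<rparr> :=\<^sub>n NV ''v'' ;;
      ''r''\<lparr>NV ''leaf''\<rparr> :=\<^sub>n NC 0 ;;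
      ''r''\<lparr>NV ''v''\<rparr> :=\<^sub>n (NAt ''r'' (NV ''v'') -\<^sub>n NC 1) ;;
      IF (NAt ''r'' (NV ''v'') =\<^sub>n NC 1) &\<^sub>b (NV ''v'' <\<^sub>n NV ''ptr'')
        THEN ''leaf'' :=\<^sub>n NV ''v''
        ELSE next_leaf ;;
      incr ''t''))"

lemma decode_code_eq: "decode_code =
   (''p'' :=\<^sub>n NC 0 ;;
    ''i'' :=\<^sub>n NC 0 ;;
    label_loop ;;
    ''t'' :=\<^sub>n NC 0 ;;
    count_loop ;;
    ''ptr'' :=\<^sub>n NC 0 ;;
    next_leaf ;;
    ''t'' :=\<^sub>n NC 0 ;;
    peel_loop ;;
    ''U''\<lparr>NV ''t''\<rparr> :=\<^sub>n NV ''leaf'' ;;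
    ''V''\<lparr>NV ''t''\<rparr> :=\<^sub>n (NV ''m'' -\<^sub>n NC 1))"
  by (simp add: decode_code_def label_loop_def label_inner_def count_loop_def peel_loop_def)

lemma label_inner:
  assumes "nreg s ''k'' = 0"
  shows "wp \<omega> label_inner s (\<lambda>t. nreg t ''p'' = nreg s ''p'' + nreg s ''rho'' \<and>
     (\<forall>q<nreg s ''p'' + nreg s ''rho''.
        narr t ''phi'' q = (if q < nreg s ''p'' then narr s ''phi'' q else nreg s ''i'') \<and>
        narr t ''r'' q = (if q < nreg s ''p'' then narr s ''r'' q else 1)) \<and>
     steps t \<le> steps s + 20 * nreg s ''rho'' + 4 \<and> real_work t = real_work s)"
  unfolding label_inner_def
proof (rule wp_While[where I = "\<lambda>t. let k = nreg t ''k'' in k \<le> nreg s ''rho'' \<and>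
     nreg t ''rho'' = nreg s ''rho'' \<and> nreg t ''i'' = nreg s ''i'' \<and>
     nreg t ''p'' = nreg s ''p'' + k \<and>
     (\<forall>q<nreg s ''p'' + k.
        narr t ''phi'' q = (if q < nreg s ''p'' then narr s ''phi'' q else nreg s ''i'') \<and>
        narr t ''r'' q = (if q < nreg s ''p'' then narr s ''r'' q else 1)) \<and>
     steps t \<le> steps s + 20 * k \<and> real_work t = real_work s"
     and f = "\<lambda>t. nreg s ''rho'' - nreg t ''k''"], goal_cases)
  case 1
  then show ?case using assms by simp
next
  case (2 t)
  then show ?case
    by (simp add: wp_simps wp_incr Let_def All_less_Suc)
next
  case (3 t)
  hence "nreg t ''k'' = nreg s ''rho''" by (simp add: Let_def)
  with 3 show ?case by (simp add: Let_def)
qed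

lemma label_loop:
  assumes "nreg s ''i'' = 0" "nreg s ''p'' = 0" "nreg s ''rho'' \<ge> 1"
  defines "d \<equiv> nreg s ''d''" and "\<rho> \<equiv> nreg s ''rho''"
  shows "wp \<omega> label_loop s (\<lambda>t. (\<forall>q<\<rho> * d. narr t ''phi'' q = q div \<rho> \<and> narr t ''r'' q = 1) \<and>
     steps t \<le> steps s + 60 * (\<rho> * d) + 4 \<and> real_work t = real_work s)"
  unfolding label_loop_def
proof (rule wp_While[where I = "\<lambda>t. let i = nreg t ''i'' in i \<le> d \<and>
     nreg t ''rho'' = \<rho> \<and> nreg t ''d'' = d \<and> nreg t ''p'' = i * \<rho> \<and>
     (\<forall>q<i * \<rho>. narr t ''phi'' q = q div \<rho> \<and> narr t ''r'' q = 1) \<and>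
     steps t \<le> steps s + 60 * (i * \<rho>) \<and> real_work t = real_work s"
     and f = "\<lambda>t. d - nreg t ''i''"], goal_cases)
  case 1
  then show ?case using assms by simp
next
  case (2 t)
  define i where "i = nreg t ''i''"
  have t: "i < d" "nreg t ''rho'' = \<rho>" "nreg t ''d'' = d" "nreg t ''p'' = i * \<rho>"
     "\<And>q. q < i * \<rho> \<Longrightarrow> narr t ''phi'' q = q div \<rho> \<and> narr t ''r'' q = 1"
     "steps t \<le> steps s + 60 * (i * \<rho>)" "real_work t = real_work s"
    using 2 by (simp_all add: Let_def i_def)
  \<comment> \<open>This lets the constant overhead of a row be charged to its \<open>\<rho>\<close>
    labels.\<close>
  have \<rho>: "\<rho> \<ge> 1" using assms by simp
  have div: "q div \<rho> = i" if "q < i * \<rho> + \<rho>" "\<not> q < i * \<rho>" for q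
    using that by (intro div_nat_eqI) (simp_all add: mult.commute)
  show ?case
    apply (simp add: wp_simps wp_incr)
    apply (rule wp_mono[OF label_inner])
     apply simp
    apply (frule exec_frame(1)[of _ _ _ _ "''d''"])
     apply (simp add: label_inner_def incr_def)
    apply (frule exec_frame(1)[of _ _ _ _ "''i''"])
     apply (simp add: label_inner_def incr_def)
    apply (frule exec_frame(1)[of _ _ _ _ "''rho''"])
     apply (simp add: label_inner_def incr_def)
    subgoal premises prems for u
      using prems(2-) t(1-4,6,7) t(5) div \<rho> by (auto simp: i_def[symmetric] Let_def add.commute)
    done
next
  case (3 t)
  hence "nreg t ''i'' = d" by (simp add: Let_def)
  with 3 show ?case by (simp add: Let_def mult.commute)
qed

lemma count_loop:
  assumes "nreg s ''t'' = 0"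
  defines "n \<equiv> nreg s ''m'' - 2"
  shows "wp \<omega> count_loop s (\<lambda>t.
     (\<forall>p. narr t ''r'' p = narr s ''r'' p + count_list (map (narr s ''S'') [0..<n]) p) \<and>
     steps t \<le> steps s + 40 * n + 6 \<and> real_work t = real_work s)"
  unfolding count_loop_def
proof (rule wp_While[where I = "\<lambda>t. let k = nreg t ''t'' in k \<le> n \<and>
     nreg t ''m'' = nreg s ''m'' \<and> narr t ''S'' = narr s ''S'' \<and>
     (\<forall>p. narr t ''r'' p = narr s ''r'' p + count_list (map (narr s ''S'') [0..<k]) p) \<and>
     steps t \<le> steps s + 40 * k \<and> real_work t = real_work s"
     and f = "\<lambda>t. n - nreg t ''t''"], goal_cases)
  case 1
  then show ?case using assms by simp
next
  case (2 t)
  then show ?case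
    by (simp add: wp_simps wp_incr Let_def n_def)
next
  case (3 t)
  hence "nreg t ''t'' = n" by (simp add: Let_def n_def)
  with 3 show ?case by (simp add: Let_def)
qed

text \<open>The witness \<open>q\<close> stops the scan. The time is charged to the movement of the
  pointer, so that it telescopes over repeated calls; additions on both sides avoid truncated
  subtraction.\<close>

lemma next_leaf:
  assumes ex: "nreg s ''ptr'' \<le> q" "narr s ''r'' q = 1"
  shows "wp \<omega> next_leaf s (\<lambda>t. nreg t ''leaf'' = nreg t ''ptr'' \<and> nreg s ''ptr'' \<le> nreg t ''ptr'' \<and>
     narr s ''r'' (nreg t ''ptr'') = 1 \<and>
     (\<forall>p. nreg s ''ptr'' \<le> p \<and> p < nreg t ''ptr'' \<longrightarrow> narr s ''r'' p \<noteq> 1) \<and>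
     steps t + 20 * nreg s ''ptr'' \<le> steps s + 20 * nreg t ''ptr'' + 10 \<and> real_work t = real_work s)"
  unfolding next_leaf_def wp_Seq
proof (rule wp_While[where I = "\<lambda>t. narr t ''r'' = narr s ''r'' \<and> nreg s ''ptr'' \<le> nreg t ''ptr'' \<and>
     nreg t ''ptr'' \<le> q \<and>
     (\<forall>p. nreg s ''ptr'' \<le> p \<and> p < nreg t ''ptr'' \<longrightarrow> narr s ''r'' p \<noteq> 1) \<and>
     steps t + 20 * nreg s ''ptr'' \<le> steps s + 20 * nreg t ''ptr'' \<and> real_work t = real_work s"
     and f = "\<lambda>t. q - nreg t ''ptr''"], goal_cases)
  case 1
  then show ?case using assms by simp
next
  case (2 t)
  hence "nreg t ''ptr'' \<noteq> q" using ex by auto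
  hence "nreg t ''ptr'' < q" using 2 by simp
  with 2 show ?case by (auto simp: wp_incr less_Suc_eq)
next
  case (3 t)
  then show ?case by (simp add: wp_simps)
qed

text \<open>\<open>R\<close> is the set of labels not yet removed and \<open>K\<close> the rest of the code.\<close>

definition peel_inv :: "nat \<Rightarrow> nat set \<Rightarrow> (nat \<Rightarrow> nat) \<Rightarrow> nat list \<Rightarrow> nat \<Rightarrow> nat \<Rightarrow> bool" where
  "peel_inv m R r K leaf ptr \<longleftrightarrow> R \<subseteq> {..<m} \<and> m - 1 \<in> R \<and> K \<in> prufer_codes R \<and>
     (\<forall>p<m. r p = (if p \<in> R then 1 + count_list K p else 0)) \<and>
     leaf \<in> R \<and> leaf \<notin> set K \<and> leaf \<le> ptr \<and> ptr < m \<and> (\<forall>p<ptr. r p = 1 \<longrightarrow> p = leaf)"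

text \<open>A smaller candidate would lie below the pointer, where only \<open>leaf\<close> itself
  can have count 1. So the machine removes the label that \<open>ARG_MIN\<close> would
  choose.\<close>

lemma peel_inv_leaf_least:
  assumes "peel_inv m R r K leaf ptr" "p \<in> R" "p \<notin> set K"
  shows "leaf \<le> p"
proof (rule ccontr)
  assume "\<not> leaf \<le> p"
  moreover have "r p = 1" using assms by (auto simp: peel_inv_def count_list_0_iff)
  moreover have "leaf \<le> ptr" "\<forall>p<ptr. r p = 1 \<longrightarrow> p = leaf"
    using assms(1) by (simp_all add: peel_inv_def)
  ultimately show False by (metis less_le_trans nat_le_linear not_le order_refl)
qed

text \<open>There are always two leaves, and the smaller one is removed.\<close>

lemma peel_inv_leaf_less:
  assumes inv: "peel_inv m R r K leaf ptr"
  shows "leaf < m - 1"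
proof -
  have "K \<in> prufer_codes R" using inv by (simp add: peel_inv_def)
  hence "card (insert leaf (set K)) < card R"
    using card_length[of K] by (auto simp: prufer_codes_def card_insert_if)
  then obtain l where l: "l \<in> R" "l \<notin> insert leaf (set K)"
    using card_less_obtain_min[of "insert leaf (set K)" R id] by blast
  hence "leaf < l" using peel_inv_leaf_least[OF inv l(1)] by simp
  moreover have "l < m" using l(1) inv by (auto simp: peel_inv_def)
  ultimately show ?thesis by simp
qed

text \<open>\<open>K\<close> is shorter than the number of labels in \<open>R\<close>, so some label
  of \<open>R\<close> is missing from \<open>K\<close> and has count 1. It is not below the pointer,
  hence a forward scan finds the least one.\<close>

lemma peel_inv_next_leaf:
  assumes "R \<subseteq> {..<m}" "m - 1 \<in> R" "K \<in> prufer_codes R"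
    and r: "\<And>p. p < m \<Longrightarrow> r p = (if p \<in> R then 1 + count_list K p else 0)"
    and none: "\<And>p. p < ptr \<Longrightarrow> r p \<noteq> 1"
  shows "\<exists>q\<ge>ptr. r q = 1"
    and "\<lbrakk>ptr \<le> ptr'; r ptr' = 1; \<And>p. \<lbrakk>ptr \<le> p; p < ptr'\<rbrakk> \<Longrightarrow> r p \<noteq> 1\<rbrakk>
      \<Longrightarrow> peel_inv m R r K ptr' ptr'"
proof -
  have "card (set K) < card R" using assms(3) card_length[of K] by (simp add: prufer_codes_def)
  then obtain q where q: "q \<in> R" "q \<notin> set K" using card_less_obtain_min[of "set K" R id] by blast
  have qm: "q < m" using q(1) assms(1) by auto
  have rq: "r q = 1" using r[OF qm] q by (simp add: count_list_0_iff)
  have "ptr \<le> q" using none[of q] rq by (metis not_le)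
  thus "\<exists>q\<ge>ptr. r q = 1" using rq by blast
  assume p': "ptr \<le> ptr'" "r ptr' = 1" "\<And>p. \<lbrakk>ptr \<le> p; p < ptr'\<rbrakk> \<Longrightarrow> r p \<noteq> 1"
  have none': "r p \<noteq> 1" if "p < ptr'" for p using none[of p] p'(3)[of p] that by (cases "p < ptr") auto
  have m: "ptr' < m" using none'[of q] rq qm by (metis le_less_trans not_le)
  have "(if ptr' \<in> R then 1 + count_list K ptr' else 0) = 1" using r[OF m] p'(2) by metis
  hence "ptr' \<in> R" "ptr' \<notin> set K" by (simp_all add: count_list_0_iff split: if_splits)
  thus "peel_inv m R r K ptr' ptr'" unfolding peel_inv_def
    using assms(1-3) r none' m by simp
qed

text \<open>Apart from the removed leaf, only the count of \<open>v\<close> drops, so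
  \<open>v\<close> is the only label below the pointer that can become a leaf, and it is then the
  least. Otherwise no leaf is below the pointer, and scanning resumes there.\<close>

lemma peel_inv_step:
  assumes inv: "peel_inv m R r (v # K) leaf ptr"
  defines "r' \<equiv> (r(leaf := 0))(v := r v - 1)"
  shows "v \<noteq> leaf" and "v < m"
    and "prufer_decode id R (v # K) = insert {leaf, v} (prufer_decode id (R - {leaf}) K)"
    and "r' v = 1 \<and> v < ptr \<Longrightarrow> peel_inv m (R - {leaf}) r' K v ptr"
    and "\<not> (r' v = 1 \<and> v < ptr) \<Longrightarrow> \<exists>q\<ge>ptr. r' q = 1"
    and "\<lbrakk>\<not> (r' v = 1 \<and> v < ptr); ptr \<le> ptr'; r' ptr' = 1;
      \<And>p. \<lbrakk>ptr \<le> p; p < ptr'\<rbrakk> \<Longrightarrow> r' p \<noteq> 1\<rbrakk> \<Longrightarrow> peel_inv m (R - {leaf}) r' K ptr' ptr'"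
proof -
  have sub: "R \<subseteq> {..<m}" and m: "m - 1 \<in> R" and code: "v # K \<in> prufer_codes R"
    and r: "\<And>p. p < m \<Longrightarrow> r p = (if p \<in> R then 1 + count_list (v # K) p else 0)"
    and leaf: "leaf \<in> R" "leaf \<notin> set (v # K)" "leaf \<le> ptr" "ptr < m"
    and below: "\<And>p. p < ptr \<Longrightarrow> r p = 1 \<Longrightarrow> p = leaf"
    using inv by (auto simp: peel_inv_def)
  show vl: "v \<noteq> leaf" using leaf by auto
  have vR: "v \<in> R" using code by (simp add: prufer_codes_def)
  show vm: "v < m" using vR sub by auto
  show "prufer_decode id R (v # K) = insert {leaf, v} (prufer_decode id (R - {leaf}) K)"
    using peel_inv_leaf_least[OF inv] leaf by (intro prufer_decode_Cons) auto
  have sub': "R - {leaf} \<subseteq> {..<m}" using sub by auto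
  \<comment> \<open>The largest label survives every step, which is why the program can store
    \<open>m - 1\<close> as an end of the last edge.\<close>
  have m': "m - 1 \<in> R - {leaf}" using m peel_inv_leaf_less[OF inv] by auto
  have code': "K \<in> prufer_codes (R - {leaf})"
    using code leaf prufer_codes_finite[OF code] by (auto simp: prufer_codes_def)
  have r': "r' p = (if p \<in> R - {leaf} then 1 + count_list K p else 0)" if "p < m" for p
    using r[OF that] vl vR unfolding r'_def by auto
  have below': "p = v" if "p < ptr" "r' p = 1" for p
    using that below[of p] by (auto simp: r'_def split: if_splits)
  show "peel_inv m (R - {leaf}) r' K v ptr" if v: "r' v = 1 \<and> v < ptr"
  proof -
    have "v \<notin> set K" using r'[OF vm] v vl vR by (auto simp: count_list_0_iff)
    thus ?thesis unfolding peel_inv_def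
      using sub' m' code' r' below' v vl vR leaf(4) by auto
  qed
  {
    assume nv: "\<not> (r' v = 1 \<and> v < ptr)"
    have none: "r' p \<noteq> 1" if "p < ptr" for p using below'[of p] nv that by auto
    show "\<exists>q\<ge>ptr. r' q = 1"
      by (rule peel_inv_next_leaf(1)[OF sub' m' code' r' none])
    show "peel_inv m (R - {leaf}) r' K ptr' ptr'"
      if "ptr \<le> ptr'" "r' ptr' = 1" "\<And>p. \<lbrakk>ptr \<le> p; p < ptr'\<rbrakk> \<Longrightarrow> r' p \<noteq> 1"
      by (rule peel_inv_next_leaf(2)[OF sub' m' code' r' none that])
  }
qed

lemma image_edges_Suc:
  "(\<lambda>x. {if x = n then u else f x, if x = n then v else g x}) ` {..<Suc n} =
    insert {u, v} ((\<lambda>x. {f x, g x}) ` {..<n})"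
  by (simp add: lessThan_Suc)

lemma next_leaf_frame:
  assumes "exec \<omega> next_leaf s t"
  shows "narr t = narr s \<and> nreg t ''t'' = nreg s ''t'' \<and> nreg t ''m'' = nreg s ''m''"
  using exec_frame(1,3)[OF assms] by (auto simp: next_leaf_def incr_def)

text \<open>The stored edges together with the decoding of the rest of the code always make up the
  whole tree. The pointer stays below \<open>m\<close>, so the term with \<open>ptr\<close> bounds
  all scans together by \<open>20 * m\<close>.\<close>

lemma peel_loop:
  assumes t0: "nreg s ''t'' = 0"
  defines "m \<equiv> nreg s ''m''"
  defines "n \<equiv> m - 2"
  defines "L \<equiv> map (narr s ''S'') [0..<n]"
  assumes inv: "peel_inv m {..<m} (narr s ''r'') L (nreg s ''leaf'') (nreg s ''ptr'')"
  shows "wp \<omega> peel_loop s (\<lambda>t. nreg t ''t'' = n \<and> nreg t ''leaf'' < m - 1 \<and>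
     (\<forall>k<n. narr t ''U'' k < m \<and> narr t ''V'' k < m) \<and>
     insert {nreg t ''leaf'', m - 1} ((\<lambda>k. {narr t ''U'' k, narr t ''V'' k}) ` {..<n}) =
       prufer_decode id {..<m} L \<and>
     steps t \<le> steps s + 120 * m + 10 \<and> real_work t = real_work s)"
  unfolding peel_loop_def
proof (rule wp_While[where I = "\<lambda>t. let k = nreg t ''t'' in k \<le> n \<and>
     nreg t ''m'' = m \<and> narr t ''S'' = narr s ''S'' \<and>
     (\<exists>R. peel_inv m R (narr t ''r'') (drop k L) (nreg t ''leaf'') (nreg t ''ptr'') \<and>
       (\<lambda>k. {narr t ''U'' k, narr t ''V'' k}) ` {..<k} \<union> prufer_decode id R (drop k L) =
       prufer_decode id {..<m} L) \<and>
     (\<forall>k'<k. narr t ''U'' k' < m \<and> narr t ''V'' k' < m) \<and>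
     steps t \<le> steps s + 100 * k + 20 * nreg t ''ptr'' \<and> real_work t = real_work s"
     and f = "\<lambda>t. n - nreg t ''t''"], goal_cases)
  case 1
  then show ?case using assms by auto
next
  case (2 t)
  define k where "k = nreg t ''t''"
  have k: "k < n" using 2 by (simp add: k_def Let_def n_def)
  have t: "nreg t ''m'' = m" "narr t ''S'' = narr s ''S''"
    "\<And>k'. k' < k \<Longrightarrow> narr t ''U'' k' < m \<and> narr t ''V'' k' < m"
    "steps t \<le> steps s + 100 * k + 20 * nreg t ''ptr''" "real_work t = real_work s"
    using 2 by (simp_all add: k_def Let_def)
  obtain R where R: "peel_inv m R (narr t ''r'') (drop k L) (nreg t ''leaf'') (nreg t ''ptr'')"
    "(\<lambda>k. {narr t ''U'' k, narr t ''V'' k}) ` {..<k} \<union> prufer_decode id R (drop k L) =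
       prufer_decode id {..<m} L"
    using 2 by (auto simp: k_def Let_def)
  define v where "v = narr s ''S'' k"
  define leaf where "leaf = nreg t ''leaf''"
  define ptr where "ptr = nreg t ''ptr''"
  define r' where "r' = (narr t ''r'')(leaf := 0, v := narr t ''r'' v - 1)"
  have drop: "drop k L = v # drop (Suc k) L"
    using k by (simp add: L_def v_def Cons_nth_drop_Suc[symmetric])
  note inv = R(1)[unfolded drop, folded leaf_def ptr_def]
  note step = peel_inv_step[OF inv, folded r'_def]
  have leaf: "leaf < m" using inv by (auto simp: peel_inv_def)
  define E where "E = (\<lambda>i. {((narr t ''U'')(k := leaf)) i, ((narr t ''V'')(k := v)) i})"
  have "E ` {..<Suc k} = insert {leaf, v} ((\<lambda>k. {narr t ''U'' k, narr t ''V'' k}) ` {..<k})"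
    by (simp add: E_def fun_upd_apply image_edges_Suc)
  hence E: "E ` {..<Suc k} \<union> prufer_decode id (R - {leaf}) (drop (Suc k) L) = prufer_decode id {..<m} L"
    using R(2) unfolding drop step(3) by auto
  have E': "E = (\<lambda>i. {if i = k then leaf else narr t ''U'' i, if i = k then v else narr t ''V'' i})"
    by (auto simp: E_def)
  note UV = t(3) leaf step(2)
  show ?case
  proof (cases "r' v = 1 \<and> v < ptr")
    case True
    have ex: "\<exists>R. peel_inv m R r' (drop (Suc k) L) v ptr \<and>
        E ` {..<Suc k} \<union> prufer_decode id R (drop (Suc k) L) = prufer_decode id {..<m} L"
      using step(4)[OF True] E by blast
    show ?thesis
      using k t leaf step(1,2) True[unfolded r'_def] ex[unfolded E' r'_def]
      by (simp add: wp_simps wp_incr Let_def k_def[symmetric] leaf_def[symmetric] ptr_def[symmetric]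
          v_def[symmetric] All_less_Suc diff_less_mono2)
  next
    case False
    obtain q where q: "ptr \<le> q" "r' q = 1" using step(5)[OF False] by blast
    have F: "(narr t ''r'' v - Suc 0 = Suc 0 \<and> v < ptr) = False" using False by (simp add: r'_def)
    show ?thesis
      using step(1)
      apply (simp add: wp_simps wp_incr Let_def k_def[symmetric] leaf_def[symmetric]
          ptr_def[symmetric] v_def[symmetric] All_less_Suc t(2) F del: not_gr_zero)
      apply (rule wp_mono[OF next_leaf[where q = q]])
        apply (simp add: q ptr_def[symmetric])
       apply (use q(2) in \<open>simp add: r'_def\<close>)
      apply (drule next_leaf_frame)
      apply (simp add: k_def[symmetric] ptr_def[symmetric] r'_def[symmetric])
      subgoal premises prems for u
      proof -
        define ptr' where "ptr' = nreg u ''ptr''"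
        have "r' ptr' = 1" "ptr \<le> ptr'" "\<And>p. \<lbrakk>ptr \<le> p; p < ptr'\<rbrakk> \<Longrightarrow> r' p \<noteq> 1"
          using prems(2) by (simp_all add: r'_def ptr'_def)
        note step(6)[OF False this(2,1,3)]
        with E have "\<exists>R. peel_inv m R r' (drop (Suc k) L) ptr' ptr' \<and>
            E ` {..<Suc k} \<union> prufer_decode id R (drop (Suc k) L) = prufer_decode id {..<m} L"
          by blast
        thus ?thesis using prems(2) k t leaf step(2) unfolding E' r'_def
          by (simp add: ptr'_def[symmetric] ptr_def[symmetric])
      qed
      done
  qed
next
  case (3 t)
  hence k: "nreg t ''t'' = n" by (simp add: Let_def n_def)
  have L: "drop n L = []" by (simp add: L_def)
  obtain R where inv: "peel_inv m R (narr t ''r'') [] (nreg t ''leaf'') (nreg t ''ptr'')"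
    and dec: "(\<lambda>k. {narr t ''U'' k, narr t ''V'' k}) ` {..<n} \<union> prufer_decode id R [] =
       prufer_decode id {..<m} L"
    using 3 k L by (auto simp: Let_def)
  have lm: "nreg t ''leaf'' < m - 1" using peel_inv_leaf_less[OF inv] .
  \<comment> \<open>With the code used up, the two remaining labels are the current leaf and
    \<open>m - 1\<close>, and they form the last edge.\<close>
  have "card R = 2" "m - 1 \<in> R" "nreg t ''leaf'' \<in> R" "nreg t ''ptr'' < m"
    using inv by (auto simp: peel_inv_def prufer_codes_def)
  hence "R = {nreg t ''leaf'', m - 1}" using lm by (auto simp: card_2_iff)
  with dec have "insert {nreg t ''leaf'', m - 1} ((\<lambda>k. {narr t ''U'' k, narr t ''V'' k}) ` {..<n}) =
       prufer_decode id {..<m} L" by (simp add: prufer_decode_Nil Un_commute)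
  moreover have "n \<le> m" by (simp add: n_def)
  ultimately show ?case using 3 k lm \<open>nreg t ''ptr'' < m\<close> by (simp add: Let_def)
qed


lemma decode_code:
  assumes m: "nreg s ''m'' = \<rho> * d" "2 \<le> \<rho> * d" and \<rho>: "nreg s ''rho'' = \<rho>" "1 \<le> \<rho>"
    and d: "nreg s ''d'' = d"
    and S: "\<And>k. k < \<rho> * d - 2 \<Longrightarrow> narr s ''S'' k < \<rho> * d"
  defines "m \<equiv> \<rho> * d"
  shows "wp \<omega> decode_code s (\<lambda>t. (\<forall>q<m. narr t ''phi'' q = q div \<rho>) \<and>
     (\<forall>k<m - 1. narr t ''U'' k < m \<and> narr t ''V'' k < m) \<and>
     (\<lambda>k. {narr t ''U'' k, narr t ''V'' k}) ` {..<m - 1} =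
       prufer_decode id {..<m} (map (narr s ''S'') [0..<m - 2]) \<and>
     steps t \<le> steps s + 300 * m \<and> real_work t = real_work s)"
proof -
  define L where "L = map (narr s ''S'') [0..<m - 2]"
  have m2: "2 \<le> m" using m by (simp add: m_def)
  have code: "L \<in> prufer_codes {..<m}"
    using S m2 by (auto simp: L_def m_def prufer_codes_def)
  show ?thesis
    unfolding decode_code_eq
    apply (simp add: wp_simps)
    apply (rule wp_mono[OF label_loop])
       apply simp
      apply simp
     apply (use \<rho> in simp)
    apply (simp add: \<rho> d m)
    subgoal premises prems for t1
    proof -
      note e1 = prems(1) and t1 = prems(2)
      have f1: "nreg t1 ''m'' = m" "narr t1 ''S'' = narr s ''S''"
        using exec_frame(1)[OF e1, of "''m''"] exec_frame(3)[OF e1, of "''S''"] m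
        by (simp_all add: label_loop_def label_inner_def incr_def m_def)
      show ?thesis
        apply (rule wp_mono[OF count_loop])
         apply simp
        apply (simp add: f1 L_def[symmetric])
        subgoal premises prems for t2
        proof -
          note e2 = prems(1) and t2 = prems(2)
          have f2: "nreg t2 ''m'' = m" "narr t2 ''S'' = narr s ''S''" "narr t2 ''phi'' = narr t1 ''phi''"
            using exec_frame(1)[OF e2, of "''m''"] exec_frame(3)[OF e2, of "''S''"]
              exec_frame(3)[OF e2, of "''phi''"] f1
            by (simp_all add: count_loop_def incr_def)
          have r: "narr t2 ''r'' p = (if p \<in> {..<m} then 1 + count_list L p else 0)" if "p < m" for p
            using that t1 t2 by (simp add: m_def)
          have m1: "m - 1 \<in> {..<m}" using m2 by simp
          \<comment> \<open>With the pointer at 0 nothing lies below it, so the first scan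
            establishes the invariant.\<close>
          note leaf = peel_inv_next_leaf[OF subset_refl m1 code r, of 0, simplified]
          obtain q where q: "narr t2 ''r'' q = 1" using leaf(1) by auto
          show ?thesis
            apply (rule wp_mono[OF next_leaf[where q = q]])
              apply simp
             apply (simp add: q)
            subgoal premises prems for t3
            proof -
              note e3 = prems(1) and t3 = prems(2)
              note f3 = next_leaf_frame[OF e3]
              have inv: "peel_inv m {..<m} (narr t2 ''r'') L (nreg t3 ''leaf'') (nreg t3 ''ptr'')"
                using leaf(2)[of "nreg t3 ''ptr''"] t3 by simp
              show ?thesis
                apply (rule wp_mono[OF peel_loop])
                  apply simp
                 apply (use inv f2 f3 in \<open>simp add: L_def\<close>)
                subgoal premises prems for t4
                proof -
                  note e4 = prems(1) and t4 = prems(2)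
                  have f4: "nreg t4 ''m'' = m" "narr t4 ''phi'' = narr t1 ''phi''"
                    using exec_frame(1)[OF e4, of "''m''"] exec_frame(3)[OF e4, of "''phi''"] f2 f3
                    by (simp_all add: peel_loop_def incr_def next_leaf_def)
                  \<comment> \<open>In this form the last edge, stored at position
                    \<open>m - 2\<close>, extends the image from \<open>m - 2\<close> to
                    \<open>m - 1\<close> positions.\<close>
                  obtain n where n: "m = Suc (Suc n)" using m2 by (metis add_2_eq_Suc le_iff_add)
                  have n': "\<rho> * d = Suc (Suc n)" using n by (simp add: m_def)
                  have "nreg t3 ''ptr'' < m" using inv by (simp add: peel_inv_def)
                  with t1 t2 t3 t4 f1 f2 f3 f4 show ?thesis
                    by (simp add: n n' All_less_Suc L_def image_edges_Suc)
                qed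
                done
            qed
            done
        qed
        done
    qed
    done
qed


section \<open>Contraction of the stored tree\<close>

text \<open>A triple costs four real operations and one write to \<open>H\<close>; an edge inside a
  block costs no real work. Hence the bound in terms of the output size.\<close>

lemma contract_tree:
  assumes m: "1 \<le> nreg s ''m''"
    and UV: "\<And>k. k < nreg s ''m'' - 1 \<Longrightarrow> narr s ''U'' k < nreg s ''m'' \<and> narr s ''V'' k < nreg s ''m''"
  defines "n \<equiv> nreg s ''m'' - 1" and "a \<equiv> rarr s ''a''" and "\<rho> \<equiv> nreg s ''rho''"
  defines "i \<equiv> \<lambda>k. narr s ''phi'' (narr s ''U'' k)" and "j \<equiv> \<lambda>k. narr s ''phi'' (narr s ''V'' k)"
  shows "wp \<omega> contract_tree s (\<lambda>t.
     output_of t = {#({i k, j k}, a (i k) * a (j k) / (real \<rho> * (a (i k) + a (j k)))).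
        k \<in># filter_mset (\<lambda>k. i k \<noteq> j k) (mset_set {..<n})#} \<and>
     steps t \<le> steps s + 80 * n + 10 \<and> real_work t \<le> real_work s + 5 * size (output_of t))"
proof -
  define g where "g = (\<lambda>k. ({i k, j k}, a (i k) * a (j k) / (real \<rho> * (a (i k) + a (j k)))))"
  show ?thesis
    unfolding contract_tree_def wp_Seq wp_basic g_def[symmetric]
  proof (rule wp_While[where I = "\<lambda>t. let k = nreg t ''t'' in k \<le> n \<and>
      nreg t ''m'' = nreg s ''m'' \<and> nreg t ''rho'' = \<rho> \<and>
      narr t ''U'' = narr s ''U'' \<and> narr t ''V'' = narr s ''V'' \<and> narr t ''phi'' = narr s ''phi'' \<and>
      rarr t ''a'' = a \<and>
      output_of t = image_mset g (filter_mset (\<lambda>k. i k \<noteq> j k) (mset_set {..<k})) \<and>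
      steps t \<le> steps s + 4 + 80 * k \<and> real_work t \<le> real_work s + 5 * nreg t ''count''"
     and f = "\<lambda>t. n - nreg t ''t''"], goal_cases)
    case 1
    then show ?case by (simp add: output_of_def a_def \<rho>_def)
  next
    case (2 t)
    define k where "k = nreg t ''t''"
    define c where "c = nreg t ''count''"
    have k: "k < n" using 2 by (simp add: k_def Let_def n_def)
    have t: "nreg t ''m'' = nreg s ''m''" "nreg t ''rho'' = \<rho>"
      "narr t ''U'' = narr s ''U''" "narr t ''V'' = narr s ''V''" "narr t ''phi'' = narr s ''phi''"
      "rarr t ''a'' = a"
      "steps t \<le> steps s + 4 + 80 * k" "real_work t \<le> real_work s + 5 * c"
      using 2 by (simp_all add: k_def c_def Let_def)
    define out where "out = output_of t"
    have out: "out = image_mset g (filter_mset (\<lambda>k. i k \<noteq> j k) (mset_set {..<k}))"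
      using 2 by (simp add: k_def Let_def out_def)
    have out_cong: "output_of u = out"
      if "nreg u ''count'' = c" "narr u ''I'' = narr t ''I''" "narr u ''J'' = narr t ''J''"
        "rarr u ''H'' = rarr t ''H''" for u
      using that by (simp add: output_of_def c_def out_def)
    \<comment> \<open>Only positions below \<open>count\<close> are read, so a write at position
      \<open>c\<close> leaves the earlier triples intact.\<close>
    have out_Suc: "output_of u = add_mset ({x, y}, z) out"
      if "nreg u ''count'' = Suc c" "narr u ''I'' = (narr t ''I'')(c := x)"
        "narr u ''J'' = (narr t ''J'')(c := y)" "rarr u ''H'' = (rarr t ''H'')(c := z)" for u x y z
    proof -
      have "{#({narr u ''I'' t, narr u ''J'' t}, rarr u ''H'' t). t \<in># mset_set {..<c}#} = out"
        unfolding out_def output_of_def c_def[symmetric] that by (intro image_mset_cong) auto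
      thus ?thesis unfolding output_of_def[of u] that(1) lessThan_Suc by (simp add: that(2-))
    qed
    show ?case
    proof (cases "i k = j k")
      case True
      then show ?thesis using k t out
        by (simp add: wp_simps wp_incr Let_def k_def[symmetric] i_def j_def out_cong
          c_def[symmetric] lessThan_Suc diff_less_mono2 del: filter_mset_mset_set)
    next
      case False
      then show ?thesis using k t out
        by (simp add: wp_simps wp_incr Let_def k_def[symmetric] i_def j_def out_Suc
          c_def[symmetric] lessThan_Suc g_def diff_less_mono2 del: filter_mset_mset_set)
    qed
  next
    case (3 t)
    hence "nreg t ''t'' = n" by (simp add: Let_def n_def)
    moreover have "size (output_of t) = nreg t ''count''" by (simp add: output_of_def)
    moreover have "output_of (charge k w t) = output_of t" for k w by (simp add: output_of_def)
    ultimately show ?case using 3 by (simp add: Let_def)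
  qed
qed

section \<open>The distribution of the code\<close>

abbreviation uniform01 :: "real measure" where
  "uniform01 \<equiv> restrict_space lborel {0..<1}"

interpretation uniform01: prob_space uniform01
  by (rule prob_spaceI) (simp add: emeasure_restrict_space space_restrict_space)

interpretation tapes: product_prob_space "\<lambda>_. uniform01" "UNIV :: nat set"
  by unfold_locales

lemma space_tapes: "space tapes = {\<omega>. \<forall>n. 0 \<le> \<omega> n \<and> \<omega> n < 1}"
  by (auto simp: tapes_def space_PiM space_restrict_space PiE_UNIV_domain)

lemma sets_uniform01: "A \<in> sets lborel \<Longrightarrow> A \<subseteq> {0..<1} \<Longrightarrow> A \<in> sets uniform01"
  by (simp add: sets_restrict_space_iff)

lemma measure_uniform01: "A \<subseteq> {0..<1} \<Longrightarrow> measure uniform01 A = measure lborel A"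
  by (simp add: measure_restrict_space)

lemma lessThan_triples:
  "(\<forall>l<n * 3. P l) \<longleftrightarrow> (\<forall>k<n. P (3 * k) \<and> P (3 * k + 1) \<and> P (3 * k + 2))" for n :: nat
proof
  assume r: "\<forall>k<n. P (3 * k) \<and> P (3 * k + 1) \<and> P (3 * k + 2)"
  show "\<forall>l<n * 3. P l"
  proof (intro allI impI)
    fix l assume l: "l < n * 3"
    hence "l div 3 < n" by (simp add: div_less_iff_less_mult)
    moreover have "l mod 3 = 0 \<or> l mod 3 = 1 \<or> l mod 3 = 2" by linarith
    moreover have "l = 3 * (l div 3) + l mod 3" by simp
    ultimately show "P l" using r by (metis add_0_right)
  qed
qed auto

text \<open>The event constrains finitely many coordinates independently of each other, so the
  product measure applies to it; the rest regroups the coordinates in threes.\<close>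

lemma measure_tapes_box:
  assumes "\<And>k. k < n \<Longrightarrow> X k \<in> sets uniform01 \<and> Y k \<in> sets uniform01 \<and> Z k \<in> sets uniform01"
  defines "E \<equiv> {\<omega> \<in> space tapes. \<forall>k<n. \<omega> (3 * k) \<in> X k \<and> \<omega> (3 * k + 1) \<in> Y k \<and> \<omega> (3 * k + 2) \<in> Z k}"
  shows "E \<in> sets tapes"
    and "measure tapes E =
      (\<Prod>k<n. measure uniform01 (X k) * measure uniform01 (Y k) * measure uniform01 (Z k))"
proof -
  \<comment> \<open>The sides of the box, indexed by tape position.\<close>
  define B where "B l = (if l mod 3 = 0 then X (l div 3) else if l mod 3 = 1 then Y (l div 3)
      else Z (l div 3))" for l
  have B: "B (3 * k) = X k" "B (3 * k + 1) = Y k" "B (3 * k + 2) = Z k" for k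
  proof -
    have "(3 * k + 1) mod 3 = 1" "(3 * k + 2) mod 3 = 2" "(3 * k + 1) div 3 = k" "(3 * k + 2) div 3 = k"
      by presburger+
    thus "B (3 * k) = X k" "B (3 * k + 1) = Y k" "B (3 * k + 2) = Z k" by (simp_all add: B_def)
  qed
  have BS: "\<forall>l<n * 3. B l \<in> sets uniform01"
    unfolding lessThan_triples B using assms(1) by blast
  have E: "E = prod_emb UNIV (\<lambda>_. uniform01) {..<n * 3} (Pi\<^sub>E {..<n * 3} B)"
  proof -
    have "E = {\<omega> \<in> space tapes. \<forall>l<n * 3. \<omega> l \<in> B l}"
      unfolding lessThan_triples B E_def ..
    thus ?thesis
      by (auto simp: prod_emb_def tapes_def space_PiM PiE_UNIV_domain restrict_PiE_iff)
  qed
  show "E \<in> sets tapes" unfolding E tapes_def using BS by (intro sets_PiM_I) auto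
  have "measure tapes E = (\<Prod>l<n * 3. measure uniform01 (B l))"
    unfolding E tapes_def using BS by (intro tapes.measure_PiM_emb) auto
  also have "\<dots> = (\<Prod>k<n. \<Prod>l\<in>{k * 3..<k * 3 + 3}. measure uniform01 (B l))"
    by (rule prod.nat_group[symmetric])
  also have "\<dots> = (\<Prod>k<n. measure uniform01 (X k) * measure uniform01 (Y k) * measure uniform01 (Z k))"
  proof (rule prod.cong[OF refl])
    fix k :: nat
    have "{k * 3..<k * 3 + 3} = {3 * k, 3 * k + 1, 3 * k + 2}" by auto
    thus "(\<Prod>l\<in>{k * 3..<k * 3 + 3}. measure uniform01 (B l)) =
        measure uniform01 (X k) * measure uniform01 (Y k) * measure uniform01 (Z k)"
      by (simp add: B[simplified] mult.assoc)
  qed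
  finally show "measure tapes E =
      (\<Prod>k<n. measure uniform01 (X k) * measure uniform01 (Y k) * measure uniform01 (Z k))" .
qed

lemma nat_floor_less: "0 \<le> u \<Longrightarrow> u < 1 \<Longrightarrow> 1 \<le> n \<Longrightarrow> nat \<lfloor>real n * u\<rfloor> < n"
  by (simp add: nat_less_iff floor_less_iff)

text \<open>The set is the half-open interval from \<open>j / n\<close> to
  \<open>(j + 1) / n\<close>.\<close>

lemma uniform01_cell:
  assumes "j < n"
  defines "A \<equiv> {u. 0 \<le> u \<and> u < 1 \<and> nat \<lfloor>real n * u\<rfloor> = j}"
  shows "A \<in> sets uniform01" "measure uniform01 A = 1 / real n"
proof -
  have n: "real n > 0" using assms(1) by simp
  have A: "A = {real j / real n..<(real j + 1) / real n}"
  proof (rule set_eqI)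
    fix u
    have "nat \<lfloor>real n * u\<rfloor> = j \<longleftrightarrow> real j \<le> real n * u \<and> real n * u < real j + 1" if "0 \<le> u"
    proof -
      have "nat \<lfloor>real n * u\<rfloor> = j \<longleftrightarrow> \<lfloor>real n * u\<rfloor> = int j" using that by auto
      thus ?thesis by (simp add: floor_eq_iff)
    qed
    moreover have "0 \<le> u" if "real j \<le> real n * u"
    proof -
      have "0 \<le> real n * u" using that of_nat_0_le_iff[of j] by linarith
      thus ?thesis using n by (simp add: zero_le_mult_iff)
    qed
    moreover have "u < 1" if "real n * u < real j + 1"
    proof -
      have "real (Suc j) \<le> real n" using assms(1) by (intro of_nat_mono) simp
      hence "real n * u < real n * 1" using that by linarith
      thus ?thesis using n by (simp only: mult_less_cancel_left_pos)
    qed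
    ultimately show "u \<in> A \<longleftrightarrow> u \<in> {real j / real n..<(real j + 1) / real n}"
      using n by (auto simp: A_def pos_divide_le_eq pos_less_divide_eq mult.commute)
  qed
  have sub: "A \<subseteq> {0..<1}" by (auto simp: A_def)
  show "A \<in> sets uniform01" by (rule sets_uniform01[OF _ sub]) (simp add: A)
  show "measure uniform01 A = 1 / real n"
    unfolding measure_uniform01[OF sub] unfolding A using n by (simp add: divide_simps)
qed

text \<open>The threshold \<open>p\<close> cuts the unit interval in two. Both pieces may name the
  same \<open>i\<close>, hence a sum of two terms instead of a case distinction.\<close>

lemma uniform01_threshold:
  fixes i j k :: nat
  assumes "0 \<le> p" "p \<le> 1"
  defines "A \<equiv> {u. 0 \<le> u \<and> u < 1 \<and> (if u < p then j else k) = i}"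
  shows "A \<in> sets uniform01"
    and "measure uniform01 A = (if j = i then p else 0) + (if k = i then 1 - p else 0)"
proof -
  have sub: "A \<subseteq> {0..<1}" by (auto simp: A_def)
  have A: "A = (if j = i then {0..<p} else {}) \<union> (if k = i then {p..<1} else {})"
    using assms(1,2) by (auto simp: A_def)
  show "A \<in> sets uniform01" by (rule sets_uniform01[OF _ sub]) (simp add: A)
  have "measure lborel A = (if j = i then p else 0) + (if k = i then 1 - p else 0)"
    unfolding A using assms(1,2) by (simp add: ivl_disj_un)
  thus "measure uniform01 A = (if j = i then p else 0) + (if k = i then 1 - p else 0)"
    by (simp add: measure_uniform01[OF sub])
qed

lemma sample_entry_less:
  assumes T: "alias_table d w p al" and d: "1 \<le> d" "1 \<le> \<rho>"
    and u: "0 \<le> x" "x < 1" "0 \<le> z" "z < 1"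
  shows "sample_entry d \<rho> p al x y z < \<rho> * d"
proof -
  define j where "j = nat \<lfloor>real d * x\<rfloor>"
  have "(if y < p j then j else al j) < d"
    using nat_floor_less[OF u(1,2) d(1)] T by (auto simp: j_def alias_table_def)
  then obtain i where i: "(if y < p j then j else al j) = i" "Suc i \<le> d" by auto
  have "i * \<rho> + nat \<lfloor>real \<rho> * z\<rfloor> < Suc i * \<rho>" using nat_floor_less[OF u(3,4) d(2)] by simp
  also have "\<dots> \<le> d * \<rho>" using i(2) by (rule mult_le_mono1)
  finally show ?thesis unfolding sample_entry_def j_def[symmetric] Let_def i(1) by (simp add: mult.commute)
qed

text \<open>Once the columns \<open>g k\<close> are fixed, the conditions on the tape numbers are
  independent. The first number of each triple determines its column, so the boxes for different
  \<open>g\<close> are disjoint.\<close>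

lemma measure_sample_entries:
  assumes T: "alias_table d w p al" and d: "1 \<le> d" "1 \<le> \<rho>"
    and c: "\<And>k. k < n \<Longrightarrow> c k < \<rho> * d"
  defines "E \<equiv> {\<omega> \<in> space tapes. \<forall>k<n.
      sample_entry d \<rho> p al (\<omega> (3 * k)) (\<omega> (3 * k + 1)) (\<omega> (3 * k + 2)) = c k}"
  shows "E \<in> sets tapes"
    and "measure tapes E = (\<Prod>k<n. w (c k div \<rho>) / real d * (1 / real \<rho>))"
proof -
  define X where "X j = {u. 0 \<le> u \<and> u < 1 \<and> nat \<lfloor>real d * u\<rfloor> = j}" for j
  define Y where "Y j i = {u. 0 \<le> u \<and> u < 1 \<and> (if u < p j then j else al j) = i}" for j i
  define Z where "Z q = {u. 0 \<le> u \<and> u < 1 \<and> nat \<lfloor>real \<rho> * u\<rfloor> = q}" for q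
  define box where "box g = {\<omega> \<in> space tapes. \<forall>k<n. \<omega> (3 * k) \<in> X (g k) \<and>
      \<omega> (3 * k + 1) \<in> Y (g k) (c k div \<rho>) \<and> \<omega> (3 * k + 2) \<in> Z (c k mod \<rho>)}" for g
  let ?G = "{..<n} \<rightarrow>\<^sub>E {..<d}"
  have p: "0 \<le> p j" "p j \<le> 1" if "j < d" for j using T that by (auto simp: alias_table_def)
  have i: "c k div \<rho> < d" if "k < n" for k
    using c[OF that] d(2) by (simp add: div_less_iff_less_mult mult.commute)
  have q: "c k mod \<rho> < \<rho>" for k using d(2) by simp
  note X = uniform01_cell[of _ d, folded X_def] and Z = uniform01_cell[OF q, folded Z_def]
  have Y: "Y j i \<in> sets uniform01"
    "measure uniform01 (Y j i) = (if j = i then p j else 0) + (if al j = i then 1 - p j else 0)"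
    if "j < d" for j i
    unfolding Y_def by (rule uniform01_threshold[OF p[OF that]])+
  have box: "box g \<in> sets tapes"
    "measure tapes (box g) = (\<Prod>k<n. 1 / real d * ((if g k = c k div \<rho> then p (g k) else 0) +
        (if al (g k) = c k div \<rho> then 1 - p (g k) else 0)) * (1 / real \<rho>))" if g: "g \<in> ?G" for g
  proof -
    have gk: "g k < d" if "k < n" for k using g that by auto
    have S: "X (g k) \<in> sets uniform01 \<and> Y (g k) (c k div \<rho>) \<in> sets uniform01 \<and>
        Z (c k mod \<rho>) \<in> sets uniform01" if "k < n" for k
      using X(1) Y(1) Z(1) gk[OF that] by blast
    show "box g \<in> sets tapes" unfolding box_def
      by (rule measure_tapes_box(1)) (use S in blast)
    have "measure tapes (box g) = (\<Prod>k<n. measure uniform01 (X (g k)) *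
        measure uniform01 (Y (g k) (c k div \<rho>)) * measure uniform01 (Z (c k mod \<rho>)))"
      unfolding box_def by (rule measure_tapes_box(2)) (use S in blast)
    also have "\<dots> = (\<Prod>k<n. 1 / real d * ((if g k = c k div \<rho> then p (g k) else 0) +
        (if al (g k) = c k div \<rho> then 1 - p (g k) else 0)) * (1 / real \<rho>))"
      using gk by (intro prod.cong) (simp_all only: lessThan_iff X(2) Y(2) Z(2))
    finally show "measure tapes (box g) = \<dots>" .
  qed
  \<comment> \<open>Uniqueness of quotient and remainder by \<open>\<rho>\<close> separates the
    condition on the label from the one on the copy.\<close>
  have entry: "sample_entry d \<rho> p al x y z = c k \<longleftrightarrow>
      y \<in> Y (nat \<lfloor>real d * x\<rfloor>) (c k div \<rho>) \<and> z \<in> Z (c k mod \<rho>)"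
    if u: "0 \<le> y" "y < 1" "0 \<le> z" "z < 1" for x y z k
  proof -
    have "i * \<rho> + q = c \<longleftrightarrow> i = c div \<rho> \<and> q = c mod \<rho>" if "q < \<rho>" for i q c
      using that d(2) by auto
    from this[OF nat_floor_less[OF u(3,4) d(2)]] show ?thesis
      using u by (simp add: sample_entry_def Y_def Z_def Let_def)
  qed
  have E: "E = (\<Union>g\<in>?G. box g)"
  proof (intro set_eqI iffI)
    fix \<omega> assume \<omega>: "\<omega> \<in> E"
    define g where "g = (\<lambda>k\<in>{..<n}. nat \<lfloor>real d * \<omega> (3 * k)\<rfloor>)"
    have u: "0 \<le> \<omega> l" "\<omega> l < 1" for l using \<omega> by (auto simp: E_def space_tapes)
    have "g \<in> ?G" using nat_floor_less[OF u d(1)] by (auto simp: g_def)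
    moreover have "\<omega> \<in> box g" using \<omega> u entry by (auto simp: E_def box_def g_def X_def)
    ultimately show "\<omega> \<in> (\<Union>g\<in>?G. box g)" by blast
  next
    fix \<omega> assume "\<omega> \<in> (\<Union>g\<in>?G. box g)"
    then obtain g where \<omega>: "\<omega> \<in> box g" by blast
    have u: "0 \<le> \<omega> l" "\<omega> l < 1" for l using \<omega> by (auto simp: box_def space_tapes)
    show "\<omega> \<in> E" using \<omega> u entry by (auto simp: E_def box_def X_def)
  qed
  have disj: "disjoint_family_on box ?G"
  proof (unfold disjoint_family_on_def, intro ballI impI)
    fix g h assume gh: "g \<in> ?G" "h \<in> ?G" "g \<noteq> h"
    then obtain k where "k < n" "g k \<noteq> h k" by (metis PiE_ext lessThan_iff)
    thus "box g \<inter> box h = {}" by (auto simp: box_def X_def)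
  qed
  have fin: "finite ?G" by (intro finite_PiE) auto
  show "E \<in> sets tapes" unfolding E using fin box(1) by (intro sets.finite_UN) auto
  have mass: "(\<Sum>j<d. (if j = i then p j else 0) + (if al j = i then 1 - p j else 0)) = w i"
    if "i < d" for i
    using T that by (simp add: sum.distrib alias_table_def)
  have "measure tapes E = (\<Sum>g\<in>?G. measure tapes (box g))"
    unfolding E tapes_def using fin box(1) disj
    by (intro tapes.finite_measure_finite_Union) (auto simp: tapes_def)
  also have "\<dots> = (\<Sum>g\<in>?G. \<Prod>k<n. 1 / real d * ((if g k = c k div \<rho> then p (g k) else 0) +
        (if al (g k) = c k div \<rho> then 1 - p (g k) else 0)) * (1 / real \<rho>))"
    by (intro sum.cong refl box(2))
  \<comment> \<open>Distributivity turns the sum over all column choices into a product over the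
    entries; each inner sum is the yield of the table.\<close>
  also have "\<dots> = (\<Prod>k<n. \<Sum>j<d. 1 / real d * ((if j = c k div \<rho> then p j else 0) +
        (if al j = c k div \<rho> then 1 - p j else 0)) * (1 / real \<rho>))"
    by (rule prod_sum_PiE[symmetric]) auto
  also have "\<dots> = (\<Prod>k<n. 1 / real d * w (c k div \<rho>) * (1 / real \<rho>))"
    by (intro prod.cong refl) (simp only: sum_distrib_left[symmetric] sum_distrib_right[symmetric]
        mass i lessThan_iff)
  finally show "measure tapes E = (\<Prod>k<n. w (c k div \<rho>) / real d * (1 / real \<rho>))" by simp
qed

section \<open>The whole program\<close>

text \<open>Decoding uses only equality and the relative order of labels, so it commutes with an
  injective relabelling when the order is pulled back along it.\<close>

lemma prufer_decode_image:
  assumes "S \<in> prufer_codes R" "inj_on f R" "inj_on rk (f ` R)"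
  shows "prufer_decode rk (f ` R) (map f S) = (`) f ` prufer_decode (rk \<circ> f) R S"
  using assms
proof (induction S arbitrary: R)
  case Nil
  show ?case by (simp add: prufer_decode_Nil)
next
  case (Cons s S)
  have inj: "inj_on (rk \<circ> f) R" using Cons.prems(2,3) by (rule comp_inj_on)
  obtain l where l: "l \<in> R" "l \<notin> set (s # S)"
    "\<And>p. \<lbrakk>p \<in> R; p \<notin> set (s # S)\<rbrakk> \<Longrightarrow> (rk \<circ> f) l \<le> (rk \<circ> f) p"
    and S: "S \<in> prufer_codes (R - {l})"
    and eq: "prufer_decode (rk \<circ> f) R (s # S) = insert {l, s} (prufer_decode (rk \<circ> f) (R - {l}) S)"
    using prufer_codes_ConsE[OF Cons.prems(1) inj] by metis
  have sub: "set (s # S) \<subseteq> R" using Cons.prems(1) by (simp add: prufer_codes_def)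
  have diff: "f ` R - {f l} = f ` (R - {l})"
    using inj_on_image_set_diff[OF Cons.prems(2), of R "{l}"] l(1) by simp
  have "f l \<notin> f ` set (s # S)"
    using l(1,2) sub by (simp only: inj_on_image_mem_iff[OF Cons.prems(2)] not_False_eq_True)
  hence "f l \<notin> set (f s # map f S)" by simp
  moreover have "rk (f l) \<le> rk q" if "q \<in> f ` R" "q \<notin> set (f s # map f S)" for q
    using that l(3) by auto
  ultimately have "prufer_decode rk (f ` R) (f s # map f S) =
      insert {f l, f s} (prufer_decode rk (f ` R - {f l}) (map f S))"
    using l(1) by (intro prufer_decode_Cons[OF Cons.prems(3)]) blast+
  also have "prufer_decode rk (f ` R - {f l}) (map f S) = (`) f ` prufer_decode (rk \<circ> f) (R - {l}) S"
    unfolding diff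
    using Cons.prems(2,3) by (intro Cons.IH[OF S]) (auto intro: inj_on_subset)
  finally show ?case unfolding eq by simp
qed

section \<open>The numbering of the copies\<close>

lemma lex_rank_copy_at [simp]: "lex_rank \<rho> (copy_at \<rho> n) = n"
  by (simp add: lex_rank_def copy_at_def)

lemma copy_at_lex_rank: "p \<in> copies d \<rho> \<Longrightarrow> copy_at \<rho> (lex_rank \<rho> p) = p"
  by (auto simp: lex_rank_def copy_at_def copies_def)

lemma lex_rank_less: "p \<in> copies d \<rho> \<Longrightarrow> lex_rank \<rho> p < \<rho> * d"
proof -
  assume "p \<in> copies d \<rho>"
  hence p: "Suc (fst p) \<le> d" "snd p < \<rho>" by (auto simp: copies_def)
  hence "lex_rank \<rho> p < Suc (fst p) * \<rho>" by (simp add: lex_rank_def)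
  also have "\<dots> \<le> d * \<rho>" using p(1) by (rule mult_le_mono1)
  finally show ?thesis by (simp add: mult.commute)
qed

lemma copy_at_in_copies: "n < \<rho> * d \<Longrightarrow> copy_at \<rho> n \<in> copies d \<rho>"
  by (cases "\<rho> = 0") (auto simp: copy_at_def copies_def div_less_iff_less_mult mult.commute)

lemma copy_at_image: "copy_at \<rho> ` {..<\<rho> * d} = copies d \<rho>"
  using copy_at_in_copies copy_at_lex_rank lex_rank_less
  by (auto simp: image_iff) (metis lessThan_iff surj_pair)

lemma inj_copy_at: "inj_on (copy_at \<rho>) A"
  by (metis inj_onI lex_rank_copy_at)

lemma inj_lex_rank: "inj_on (lex_rank \<rho>) (copies d \<rho>)"
  by (metis inj_onI copy_at_lex_rank)

lemma card_copies: "card (copies d \<rho>) = \<rho> * d"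
  by (simp add: copies_def mult.commute)

text \<open>The \<open>\<rho>\<close> copies of \<open>i\<close> share \<open>a i\<close> equally,
  so the code entries are normalised by the total weight.\<close>

lemma sum_copy_cond:
  assumes "1 \<le> \<rho>"
  shows "(\<Sum>p\<in>copies d \<rho>. copy_cond a \<rho> p) = total_weight d a"
proof -
  have "(\<Sum>p\<in>copies d \<rho>. copy_cond a \<rho> p) = (\<Sum>i<d. \<Sum>k<\<rho>. a i / real \<rho>)"
    by (simp add: copies_def copy_cond_def sum.cartesian_product case_prod_unfold
        del: sum_constant)
  also have "\<dots> = total_weight d a" using assms by (simp add: total_weight_def)
  finally show ?thesis .
qed

text \<open>The index functions are parameters so that the labels can be read from the table
  \<open>phi\<close> or computed by division.\<close>

definition edge_triples :: "(nat \<Rightarrow> real) \<Rightarrow> nat \<Rightarrow> nat \<Rightarrow> (nat \<Rightarrow> nat) \<Rightarrow> (nat \<Rightarrow> nat) \<Rightarrow> (nat set \<times> real) multiset" where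
  "edge_triples a \<rho> n i j = {#({i k, j k}, a (i k) * a (j k) / (real \<rho> * (a (i k) + a (j k)))).
     k \<in># filter_mset (\<lambda>k. i k \<noteq> j k) (mset_set {..<n})#}"

lemma edge_triples_cong:
  assumes "\<And>k. k < n \<Longrightarrow> i k = i' k \<and> j k = j' k" "\<And>k. k < n \<Longrightarrow> a (i k) = a' (i k) \<and> a (j k) = a' (j k)"
  shows "edge_triples a \<rho> n i j = edge_triples a' \<rho> n i' j'"
proof -
  have "filter_mset (\<lambda>k. i k \<noteq> j k) (mset_set {..<n}) = filter_mset (\<lambda>k. i' k \<noteq> j' k) (mset_set {..<n})"
    using assms(1) by (intro filter_mset_cong) auto
  thus ?thesis unfolding edge_triples_def
    using assms by (auto intro!: image_mset_cong)
qed

text \<open>\<open>contract\<close> ranges over distinct edges and \<open>edge_triples\<close> over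
  positions; injectivity reconciles the multiplicities. In the conductance, one of the two factors
  \<open>1 / \<rho>\<close> cancels against the denominator.\<close>

lemma contract_image:
  assumes inj: "inj_on (\<lambda>k. {copy_at \<rho> (u k), copy_at \<rho> (v k)}) {..<n}" and \<rho>: "1 \<le> \<rho>"
  defines "i \<equiv> \<lambda>k. u k div \<rho>" and "j \<equiv> \<lambda>k. v k div \<rho>"
  shows "contract a \<rho> ((\<lambda>k. {copy_at \<rho> (u k), copy_at \<rho> (v k)}) ` {..<n}) =
    edge_triples a \<rho> n i j"
proof -
  define e where "e = (\<lambda>k. {copy_at \<rho> (u k), copy_at \<rho> (v k)})"
  let ?A = "{k \<in> {..<n}. i k \<noteq> j k}"
  have fst: "fst (copy_at \<rho> (u k)) = i k" "fst (copy_at \<rho> (v k)) = j k" for k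
    by (simp_all add: copy_at_def i_def j_def)
  have "(\<exists>p\<in>e k. \<exists>q\<in>e k. fst p \<noteq> fst q) \<longleftrightarrow> i k \<noteq> j k" for k
    using fst[of k] by (auto simp: e_def simp del: split_paired_Ex)
  hence "{f \<in> e ` {..<n}. \<exists>p\<in>f. \<exists>q\<in>f. fst p \<noteq> fst q} = e ` ?A"
    by auto
  moreover have "inj_on e ?A" using inj unfolding e_def by (rule inj_on_subset) auto
  ultimately have "contract a \<rho> (e ` {..<n}) =
      {#(fst ` e k, triple_cond a \<rho> (e k)). k \<in># mset_set ?A#}"
    by (simp add: contract_def image_mset_mset_set[symmetric] multiset.map_comp comp_def)
  also have "\<dots> = {#({i k, j k}, a (i k) * a (j k) / (real \<rho> * (a (i k) + a (j k)))). k \<in># mset_set ?A#}"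
  proof (intro image_mset_cong)
    fix k assume "k \<in># mset_set ?A"
    hence "i k \<noteq> j k" by simp
    hence ne: "copy_at \<rho> (u k) \<noteq> copy_at \<rho> (v k)" using fst by metis
    have "triple_cond a \<rho> (e k) = a (i k) * a (j k) / (real \<rho> * (a (i k) + a (j k)))"
      using \<rho> by (simp add: e_def triple_cond_edge[OF ne] copy_cond_def fst
          flip: add_divide_distrib)
    thus "(fst ` e k, triple_cond a \<rho> (e k)) =
        ({i k, j k}, a (i k) * a (j k) / (real \<rho> * (a (i k) + a (j k))))"
      by (simp add: e_def fst)
  qed
  finally show ?thesis by (simp add: e_def edge_triples_def)
qed

text \<open>\<open>s\<close> is the state after decoding and \<open>t\<close> the final one. Code
  and edges are read from \<open>t\<close>, since the contraction leaves their arrays alone.\<close>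

definition schur_run :: "nat \<Rightarrow> (nat \<Rightarrow> real) \<Rightarrow> nat \<Rightarrow> (nat \<Rightarrow> real) \<Rightarrow> (nat \<Rightarrow> nat) \<Rightarrow>
    (nat \<Rightarrow> real) \<Rightarrow> state \<Rightarrow> state \<Rightarrow> bool" where
  "schur_run d a \<rho> p al \<omega> s t \<longleftrightarrow> exec \<omega> sample_tree (initial_state d a \<rho>) s \<and>
      exec \<omega> cast_schur_tree (initial_state d a \<rho>) t \<and>
      (\<forall>k<\<rho> * d - 2. narr t ''S'' k =
         sample_entry d \<rho> p al (\<omega> (3 * k)) (\<omega> (3 * k + 1)) (\<omega> (3 * k + 2))) \<and>
      (\<lambda>k. {narr t ''U'' k, narr t ''V'' k}) ` {..<\<rho> * d - 1} =
         prufer_decode id {..<\<rho> * d} (map (narr t ''S'') [0..<\<rho> * d - 2]) \<and>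
      output_of t = edge_triples a \<rho> (\<rho> * d - 1) (\<lambda>k. narr t ''U'' k div \<rho>) (\<lambda>k. narr t ''V'' k div \<rho>) \<and>
      steps t \<le> 1000 * (\<rho> * d) \<and> real_work s \<le> 1000 * d \<and>
      real_work t \<le> real_work s + 1000 * size (output_of t)"

text \<open>The order of quantification is the point: \<open>p\<close> and \<open>al\<close> are
  obtained before the tape is given.\<close>

lemma cast_schur_tree_run:
  assumes d: "2 \<le> d" and a: "\<And>i. i < d \<Longrightarrow> 0 < a i" and \<rho>: "1 \<le> \<rho>"
  obtains w p al where "alias_table d w p al" "\<And>i. i < d \<Longrightarrow> w i = real d * a i / total_weight d a"
    and "\<And>\<omega>. \<omega> \<in> space tapes \<Longrightarrow> \<exists>s t. schur_run d a \<rho> p al \<omega> s t"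
proof -
  let ?s0 = "initial_state d a \<rho>"
  define m where "m = \<rho> * d"
  have dm: "d \<le> m" and m2: "2 \<le> m" using d \<rho> mult_le_mono1[of 1 \<rho> d] unfolding m_def by linarith+
  have s0: "nreg ?s0 ''d'' = d" "nreg ?s0 ''rho'' = \<rho>" "tape_pos ?s0 = 0" "steps ?s0 = 0"
    "real_work ?s0 = 0" "rarr ?s0 ''a'' = (\<lambda>i. if i < d then a i else 0)"
    by (simp_all add: initial_state_def)
  \<comment> \<open>The zero tape is an arbitrary choice; the run obtained on it is later moved to
    every other tape.\<close>
  have "wp (\<lambda>_. 0) build_alias_table ?s0 (\<lambda>t.
     alias_table d (\<lambda>i. real d * rarr ?s0 ''a'' i / (\<Sum>i<d. rarr ?s0 ''a'' i))
       (rarr t ''prob'') (narr t ''alias'') \<and>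
     nreg t ''m'' = nreg ?s0 ''rho'' * d \<and>
     steps t \<le> steps ?s0 + 200 * d \<and> real_work t \<le> real_work ?s0 + 7 * d)"
    using d a by (intro build_alias_table) (simp_all add: s0)
  then obtain s1 where e1: "exec (\<lambda>_. 0) build_alias_table ?s0 s1"
    and T: "alias_table d (\<lambda>i. real d * rarr ?s0 ''a'' i / (\<Sum>i<d. rarr ?s0 ''a'' i))
       (rarr s1 ''prob'') (narr s1 ''alias'')" and m1: "nreg s1 ''m'' = m"
    and c1: "steps s1 \<le> 200 * d" "real_work s1 \<le> 7 * d"
    by (auto simp: wp_def s0 m_def)
  have dl: "Tape \<notin> writes build_alias_table"
    by (simp add: build_alias_table_def incr_def push_def pop_def)
  have s1: "nreg s1 ''d'' = d" "nreg s1 ''rho'' = \<rho>" "tape_pos s1 = 0"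
    "rarr s1 ''a'' = (\<lambda>i. if i < d then a i else 0)"
    using exec_frame(1)[OF e1, of "''d''"] exec_frame(1)[OF e1, of "''rho''"]
      exec_frame(4)[OF e1, of "''a''"] exec_frame(5)[OF e1] s0
    by (simp_all add: build_alias_table_def incr_def push_def pop_def)
  let ?e = "\<lambda>\<omega> k. sample_entry d \<rho> (rarr s1 ''prob'') (narr s1 ''alias'')
      (\<omega> (3 * k)) (\<omega> (3 * k + 1)) (\<omega> (3 * k + 2))"
  show thesis
  proof (rule that[OF T])
    show "real d * rarr ?s0 ''a'' i / (\<Sum>i<d. rarr ?s0 ''a'' i) = real d * a i / total_weight d a"
      if "i < d" for i using that by (simp add: s0 total_weight_def)
    fix \<omega> assume "\<omega> \<in> space tapes"
    hence u: "0 \<le> \<omega> l" "\<omega> l < 1" for l by (auto simp: space_tapes)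
    have E1: "exec \<omega> build_alias_table ?s0 s1" by (rule exec_drawless[OF e1 dl])
    obtain s2 where e2: "exec \<omega> sample_code s1 s2"
      and S: "\<And>k. k < m - 2 \<Longrightarrow> narr s2 ''S'' k = ?e \<omega> k"
      and c2: "steps s2 \<le> steps s1 + 60 * (m - 2) + 10" "real_work s2 = real_work s1"
      using sample_code[OF s1(3), of \<omega>] by (auto simp: wp_def s1 m1)
    have s2: "nreg s2 ''m'' = m" "nreg s2 ''d'' = d" "nreg s2 ''rho'' = \<rho>" "rarr s2 ''a'' = rarr s1 ''a''"
      using exec_frame(1)[OF e2, of "''m''"] exec_frame(1)[OF e2, of "''d''"]
        exec_frame(1)[OF e2, of "''rho''"] exec_frame(4)[OF e2, of "''a''"] s1 m1
      by (simp_all add: sample_code_def incr_def)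
    have S_less: "narr s2 ''S'' k < \<rho> * d" if "k < \<rho> * d - 2" for k
      using that d \<rho> u S[of k] unfolding m_def by (auto intro!: sample_entry_less[OF T])
    have "wp \<omega> decode_code s2 (\<lambda>t. (\<forall>q<\<rho> * d. narr t ''phi'' q = q div \<rho>) \<and>
     (\<forall>k<\<rho> * d - 1. narr t ''U'' k < \<rho> * d \<and> narr t ''V'' k < \<rho> * d) \<and>
     (\<lambda>k. {narr t ''U'' k, narr t ''V'' k}) ` {..<\<rho> * d - 1} =
       prufer_decode id {..<\<rho> * d} (map (narr s2 ''S'') [0..<\<rho> * d - 2]) \<and>
     steps t \<le> steps s2 + 300 * (\<rho> * d) \<and> real_work t = real_work s2)"
      using s2 m2 \<rho> S_less by (intro decode_code) (simp_all add: m_def)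
    then obtain s3 where e3: "exec \<omega> decode_code s2 s3"
      and phi: "\<And>q. q < m \<Longrightarrow> narr s3 ''phi'' q = q div \<rho>"
      and UV: "\<And>k. k < m - 1 \<Longrightarrow> narr s3 ''U'' k < m \<and> narr s3 ''V'' k < m"
      and dec: "(\<lambda>k. {narr s3 ''U'' k, narr s3 ''V'' k}) ` {..<m - 1} =
        prufer_decode id {..<m} (map (narr s2 ''S'') [0..<m - 2])"
      and c3: "steps s3 \<le> steps s2 + 300 * m" "real_work s3 = real_work s2"
      unfolding wp_def m_def by blast
    have s3: "nreg s3 ''m'' = m" "nreg s3 ''rho'' = \<rho>" "rarr s3 ''a'' = rarr s1 ''a''"
      "narr s3 ''S'' = narr s2 ''S''"
      using exec_frame(1)[OF e3, of "''m''"] exec_frame(1)[OF e3, of "''rho''"]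
        exec_frame(4)[OF e3, of "''a''"] exec_frame(3)[OF e3, of "''S''"] s2
      by (simp_all add: decode_code_def incr_def next_leaf_def)
    obtain s4 where e4: "exec \<omega> contract_tree s3 s4"
      and out: "output_of s4 = edge_triples (rarr s3 ''a'') \<rho> (m - 1)
        (\<lambda>k. narr s3 ''phi'' (narr s3 ''U'' k)) (\<lambda>k. narr s3 ''phi'' (narr s3 ''V'' k))"
      and c4: "steps s4 \<le> steps s3 + 80 * (m - 1) + 10"
        "real_work s4 \<le> real_work s3 + 5 * size (output_of s4)"
      using contract_tree[of s3 \<omega>] UV m2 unfolding wp_def s3 edge_triples_def by auto
    have s4: "narr s4 ''S'' = narr s2 ''S''" "narr s4 ''U'' = narr s3 ''U''" "narr s4 ''V'' = narr s3 ''V''"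
      using exec_frame(3)[OF e4, of "''S''"] exec_frame(3)[OF e4, of "''U''"]
        exec_frame(3)[OF e4, of "''V''"] s3
      by (simp_all add: contract_tree_def incr_def)
    have "q div \<rho> < d" if "q < m" for q
      using that \<rho> by (simp add: m_def div_less_iff_less_mult mult.commute)
    hence out': "output_of s4 = edge_triples a \<rho> (m - 1) (\<lambda>k. narr s4 ''U'' k div \<rho>) (\<lambda>k. narr s4 ''V'' k div \<rho>)"
      unfolding out using UV by (intro edge_triples_cong) (simp_all add: phi s4 s3 s1)
    have t3: "exec \<omega> sample_tree ?s0 s3"
      unfolding sample_tree_def using E1 e2 e3 by (intro exec.Seq)
    hence t4: "exec \<omega> cast_schur_tree ?s0 s4"
      unfolding cast_schur_tree_def using e4 by (rule exec.Seq)
    \<comment> \<open>The phases add up to at most \<open>200 * d + 440 * m + 20\<close> steps, and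
      \<open>d \<le> m\<close>, \<open>2 \<le> m\<close>; the real work so far is at most
      \<open>7 * d\<close>.\<close>
    have "steps s4 \<le> 1000 * m" "real_work s3 \<le> 1000 * d"
      using c1 c2 c3 c4(1) dm m2 by simp_all
    hence "schur_run d a \<rho> (rarr s1 ''prob'') (narr s1 ''alias'') \<omega> s3 s4"
      using t3 t4 S dec out' c4(2) unfolding schur_run_def m_def[symmetric] by (simp add: s4)
    thus "\<exists>s t. schur_run d a \<rho> (rarr s1 ''prob'') (narr s1 ''alias'') \<omega> s t" by blast
  qed
qed

theorem proposition3p1:
  "\<exists>C::nat. \<forall>(d::nat) (a::nat \<Rightarrow> real) (\<rho>::nat).
     2 \<le> d \<longrightarrow> (\<forall>i<d. 0 < a i) \<longrightarrow> 1 \<le> \<rho> \<longrightarrow>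
     (\<exists>mid fin.
        \<comment> \<open>every run terminates; \<open>mid\<close> is the state once the tree is decoded\<close>
        (\<forall>\<omega>\<in>space tapes. exec \<omega> sample_tree (initial_state d a \<rho>) (mid \<omega>) \<and>
           exec \<omega> cast_schur_tree (initial_state d a \<rho>) (fin \<omega>)) \<and>
        \<comment> \<open>the code has independent entries distributed as \<open>\<pi>\<close> times uniform\<close>
        (\<forall>S. length S = \<rho> * d - 2 \<and> set S \<subseteq> copies d \<rho> \<longrightarrow>
           {\<omega> \<in> space tapes. code_of d \<rho> (fin \<omega>) = S} \<in> sets tapes \<and>
           measure tapes {\<omega> \<in> space tapes. code_of d \<rho> (fin \<omega>) = S} =
             (\<Prod>p\<leftarrow>S. a (fst p) / total_weight d a * (1 / real \<rho>))) \<and>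
        (\<forall>\<omega>\<in>space tapes. tree_of d \<rho> (fin \<omega>) =
           prufer_decode (lex_rank \<rho>) (copies d \<rho>) (code_of d \<rho> (fin \<omega>))) \<and>
        \<comment> \<open>the tree is an exact sample\<close>
        (\<forall>\<omega>\<in>space tapes. tree_of d \<rho> (fin \<omega>) \<in> spanning_trees (copies d \<rho>)) \<and>
        (\<forall>T\<in>spanning_trees (copies d \<rho>).
           {\<omega> \<in> space tapes. tree_of d \<rho> (fin \<omega>) = T} \<in> sets tapes \<and>
           measure tapes {\<omega> \<in> space tapes. tree_of d \<rho> (fin \<omega>) = T} =
             rst_prob (copies d \<rho>) (exp_weight d a \<rho>) T) \<and>
        \<comment> \<open>the output is the contraction of that tree\<close>
        (\<forall>\<omega>\<in>space tapes. output_of (fin \<omega>) = contract a \<rho> (tree_of d \<rho> (fin \<omega>))) \<and>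
        \<comment> \<open>running time\<close>
        (\<forall>\<omega>\<in>space tapes. steps (fin \<omega>) \<le> C * (\<rho> * d)) \<and>
        \<comment> \<open>no clique is formed: linear real work up to the tree, then only the output triples\<close>
        (\<forall>\<omega>\<in>space tapes. real_work (mid \<omega>) \<le> C * d \<and>
           real_work (fin \<omega>) \<le> real_work (mid \<omega>) + C * size (output_of (fin \<omega>))))"
proof (intro exI[of _ 1000] allI impI, goal_cases)
  case (1 d a \<rho>)
  note d = 1(1) and a = 1(2) and \<rho> = 1(3)
  define m where "m = \<rho> * d"
  have m2: "2 \<le> m" using d \<rho> mult_le_mono1[of 1 \<rho> d] unfolding m_def by linarith
  obtain w p al where T: "alias_table d w p al"
    and w: "\<And>i. i < d \<Longrightarrow> w i = real d * a i / total_weight d a"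
    and run: "\<And>\<omega>. \<omega> \<in> space tapes \<Longrightarrow> \<exists>s t. schur_run d a \<rho> p al \<omega> s t"
    by (rule cast_schur_tree_run[OF d _ \<rho>, of a]) (use a in blast)+
  let ?e = "\<lambda>\<omega> k. sample_entry d \<rho> p al (\<omega> (3 * k)) (\<omega> (3 * k + 1)) (\<omega> (3 * k + 2))"
  obtain mid fin where "\<And>\<omega>. \<omega> \<in> space tapes \<Longrightarrow> schur_run d a \<rho> p al \<omega> (mid \<omega>) (fin \<omega>)"
    using run by metis
  note R = this[unfolded schur_run_def m_def[symmetric]]
  have pos: "0 < total_weight d a"
    unfolding total_weight_def using a d by (intro sum_pos) (auto simp: lessThan_empty_iff)
  have card: "card (copies d \<rho>) = m" by (simp add: card_copies m_def)
  have code_mem: "S \<in> prufer_codes (copies d \<rho>) \<longleftrightarrow> length S = m - 2 \<and> set S \<subseteq> copies d \<rho>" for S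
    using m2 by (auto simp: prufer_codes_def card)
  have S_less: "narr (fin \<omega>) ''S'' k < m" if "\<omega> \<in> space tapes" "k < m - 2" for \<omega> k
    using R[OF that(1)] that d \<rho> unfolding m_def space_tapes
    by (auto intro!: sample_entry_less[OF T])
  have code: "code_of d \<rho> (fin \<omega>) \<in> prufer_codes (copies d \<rho>)" if "\<omega> \<in> space tapes" for \<omega>
    using S_less[OF that] by (auto simp: code_mem code_of_def m_def intro!: copy_at_in_copies)
  have tree: "tree_of d \<rho> (fin \<omega>) = prufer_decode (lex_rank \<rho>) (copies d \<rho>) (code_of d \<rho> (fin \<omega>))"
    if \<omega>: "\<omega> \<in> space tapes" for \<omega>
  proof -
    let ?L = "map (narr (fin \<omega>) ''S'') [0..<m - 2]"
    have "?L \<in> prufer_codes {..<m}" using S_less[OF \<omega>] m2 by (auto simp: prufer_codes_def)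
    \<comment> \<open>The lexicographic order of the copies pulls back to the usual order of the
      numbers that the machine decodes.\<close>
    moreover have "lex_rank \<rho> \<circ> copy_at \<rho> = id" by auto
    moreover have "copy_at \<rho> ` {..<m} = copies d \<rho>" unfolding m_def by (rule copy_at_image)
    moreover have "map (copy_at \<rho>) ?L = code_of d \<rho> (fin \<omega>)" by (simp add: code_of_def m_def)
    ultimately have "prufer_decode (lex_rank \<rho>) (copies d \<rho>) (code_of d \<rho> (fin \<omega>)) =
        (`) (copy_at \<rho>) ` prufer_decode id {..<m} ?L"
      using prufer_decode_image[of ?L "{..<m}" "copy_at \<rho>" "lex_rank \<rho>"]
      by (simp add: inj_copy_at inj_lex_rank)
    also have "\<dots> = (`) (copy_at \<rho>) ` (\<lambda>k. {narr (fin \<omega>) ''U'' k, narr (fin \<omega>) ''V'' k}) ` {..<m - 1}"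
      using R[OF \<omega>] by simp
    also have "\<dots> = tree_of d \<rho> (fin \<omega>)" by (simp add: tree_of_def image_image m_def)
    finally show ?thesis ..
  qed
  have code_event: "{\<omega> \<in> space tapes. code_of d \<rho> (fin \<omega>) = S} \<in> sets tapes \<and>
      measure tapes {\<omega> \<in> space tapes. code_of d \<rho> (fin \<omega>) = S} =
        (\<Prod>p\<leftarrow>S. a (fst p) / total_weight d a * (1 / real \<rho>))"
    if S: "length S = m - 2" "set S \<subseteq> copies d \<rho>" for S
  proof -
    define c where "c k = lex_rank \<rho> (S ! k)" for k
    have Sk: "S ! k \<in> copies d \<rho>" if "k < m - 2" for k using S nth_mem[of k S] that by auto
    have copy: "copy_at \<rho> (c k) = S ! k" if "k < m - 2" for k
      using copy_at_lex_rank[OF Sk[OF that]] by (simp add: c_def)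
    have cm: "c k < \<rho> * d" if "k < m - 2" for k
      using lex_rank_less[OF Sk[OF that]] by (simp add: c_def)
    have "code_of d \<rho> (fin \<omega>) = S \<longleftrightarrow> (\<forall>k<m - 2. ?e \<omega> k = c k)" if \<omega>: "\<omega> \<in> space tapes" for \<omega>
    proof -
      have "code_of d \<rho> (fin \<omega>) = S \<longleftrightarrow> (\<forall>k<m - 2. copy_at \<rho> (narr (fin \<omega>) ''S'' k) = S ! k)"
        using S(1) by (auto simp: list_eq_iff_nth_eq code_of_def m_def)
      also have "\<dots> \<longleftrightarrow> (\<forall>k<m - 2. copy_at \<rho> (?e \<omega> k) = copy_at \<rho> (c k))"
        using R[OF \<omega>] copy by simp
      \<comment> \<open>\<open>copy_at \<rho>\<close> has the left inverse
        \<open>lex_rank \<rho>\<close>, so copies may be compared as numbers.\<close>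
      also have "\<dots> \<longleftrightarrow> (\<forall>k<m - 2. ?e \<omega> k = c k)" by (metis lex_rank_copy_at)
      finally show ?thesis .
    qed
    hence eq: "{\<omega> \<in> space tapes. code_of d \<rho> (fin \<omega>) = S} =
        {\<omega> \<in> space tapes. \<forall>k<m - 2. ?e \<omega> k = c k}" by blast
    have d1: "1 \<le> d" using d by simp
    note ev = measure_sample_entries[OF T d1 \<rho> cm]
    have "w (c k div \<rho>) / real d * (1 / real \<rho>) =
        a (fst (S ! k)) / total_weight d a * (1 / real \<rho>)" if "k < m - 2" for k
    proof -
      have "fst (S ! k) = c k div \<rho>" using copy[OF that] by (simp add: copy_at_def flip: copy[OF that])
      moreover have "fst (S ! k) < d" using Sk[OF that] by (auto simp: copies_def)
      ultimately show ?thesis using d by (simp add: w)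
    qed
    hence "measure tapes {\<omega> \<in> space tapes. \<forall>k<m - 2. ?e \<omega> k = c k} =
        (\<Prod>k<m - 2. a (fst (S ! k)) / total_weight d a * (1 / real \<rho>))"
      by (subst ev(2)) auto
    also have "\<dots> = (\<Prod>p\<leftarrow>S. a (fst p) / total_weight d a * (1 / real \<rho>))"
      using S(1) by (simp add: prod.list_conv_set_nth atLeast0LessThan)
    finally show ?thesis unfolding eq by (intro conjI ev(1))
  qed
  have tree_event: "{\<omega> \<in> space tapes. tree_of d \<rho> (fin \<omega>) = U} \<in> sets tapes \<and>
      measure tapes {\<omega> \<in> space tapes. tree_of d \<rho> (fin \<omega>) = U} =
        rst_prob (copies d \<rho>) (exp_weight d a \<rho>) U"
    if U: "U \<in> spanning_trees (copies d \<rho>)" for U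
  proof -
    have "card (copies d \<rho>) = (m - 2) + 2" using m2 by (simp add: card)
    then obtain S where S: "S \<in> prufer_codes (copies d \<rho>)"
      and US: "U = prufer_decode (lex_rank \<rho>) (copies d \<rho>) S"
      using prufer_decode_surj[OF inj_lex_rank U] by blast
    \<comment> \<open>Injectivity of decoding makes the event of one tree the event of one
      code.\<close>
    have "{\<omega> \<in> space tapes. tree_of d \<rho> (fin \<omega>) = U} = {\<omega> \<in> space tapes. code_of d \<rho> (fin \<omega>) = S}"
      using tree code S US prufer_decode_inj[OF inj_lex_rank] by metis
    moreover have "rst_prob (copies d \<rho>) (exp_weight d a \<rho>) U =
        (\<Prod>p\<leftarrow>S. copy_cond a \<rho> p / (\<Sum>p\<in>copies d \<rho>. copy_cond a \<rho> p))"
      unfolding US using a \<rho>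
      by (intro rst_prob_prufer_decode[OF S inj_lex_rank pos])
        (auto simp: copies_def copy_cond_def exp_weight_def)
    moreover have "\<dots> = (\<Prod>p\<leftarrow>S. a (fst p) / total_weight d a * (1 / real \<rho>))"
      unfolding sum_copy_cond[OF \<rho>] by (simp add: copy_cond_def mult.commute)
    ultimately show ?thesis using code_event[of S] S by (simp add: code_mem)
  qed
  have spanning: "tree_of d \<rho> (fin \<omega>) \<in> spanning_trees (copies d \<rho>) \<and> card (tree_of d \<rho> (fin \<omega>)) = m - 1"
    if "\<omega> \<in> space tapes" for \<omega>
    using prufer_decode_tree[OF code[OF that] inj_lex_rank] code[OF that] m2
    by (simp add: tree[OF that] code_mem)
  have out: "output_of (fin \<omega>) = contract a \<rho> (tree_of d \<rho> (fin \<omega>))" if \<omega>: "\<omega> \<in> space tapes" for \<omega>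
  proof -
    let ?E = "\<lambda>k. {copy_at \<rho> (narr (fin \<omega>) ''U'' k), copy_at \<rho> (narr (fin \<omega>) ''V'' k)}"
    have E: "tree_of d \<rho> (fin \<omega>) = ?E ` {..<m - 1}" by (simp add: tree_of_def m_def)
    \<comment> \<open>The image of the \<open>m - 1\<close> positions has \<open>m - 1\<close>
      elements, so no edge is stored twice.\<close>
    hence inj: "inj_on ?E {..<m - 1}" using spanning[OF \<omega>] by (intro eq_card_imp_inj_on) auto
    show ?thesis using R[OF \<omega>] unfolding E contract_image[OF inj \<rho>] by (elim conjE)
  qed
  show ?case unfolding m_def[symmetric]
  proof (rule exI[of _ mid], rule exI[of _ fin], intro conjI, goal_cases)
    case 1
    show ?case using R by blast
  next
    case 2
    show ?case by (intro allI impI, elim conjE, erule (1) code_event)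
  next
    case 3
    show ?case by (intro ballI, erule tree)
  next
    case 4
    show ?case using spanning by blast
  next
    case 5
    show ?case by (intro ballI, erule tree_event)
  next
    case 6
    show ?case by (intro ballI, erule out)
  next
    case 7
    show ?case using R by blast
  next
    case 8
    show ?case using R by blast
  qed
qed

end
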